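(* Let $\boldsymbol s$ be a seed pattern, $S$ a simplex of the Fomin–Zelevinsky cluster complex $\Delta^{\mathrm{FZ}}_{\boldsymbol s}$, and $\mathsf G\subset\mathrm{Exch}_{\boldsymbol s}$ the dual graph of its star. Let $\gamma:v_0\to v$ be a path contained in $\mathsf G$ which represents a mutation loop in $\Gamma^{\mathsf G}_{\boldsymbol s}\subset\Gamma_{\boldsymbol s}$. Then the path $\pi_{\mathsf G}(\gamma)$ is sign-stable on an $\mathbb R_{>0}$-invariant set $\Omega\subset\mathcal X^{\mathrm{uf}}_{\boldsymbol s|_{\mathsf G}}(\mathbb R^{\mathrm{trop}})$ if and only if $\gamma$ is sign-stable on $\widetilde\Omega:=\pi_{\mathsf G}^{-1}(\Omega\setminus\{0\})\subset\mathcal X^{\mathrm{uf}}_{\boldsymbol s}(\mathbb R^{\mathrm{trop}})$. Moreover, in this case, $$\rho\big(E^{(v_0)}_{\phi,\widetilde\Omega}\big)=\rho\big(E^{(v_0)}_{\pi_{\mathsf G}(\phi),\Omega}\big),$$ where $\phi:=[\gamma]_{\boldsymbol s}\in\Gamma^{\mathsf G}_{\boldsymbol s}$ and $\rho$ denotes the spectral radius.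
   Context: **Seed patterns.** $[a]_+=\max(a,0)$. Let $I=I_{\mathrm{uf}}\sqcup I_{\mathrm f}$ be finite and $\mathbb T_{I_{\mathrm{uf}}}$ the $|I_{\mathrm{uf}}|$-regular tree with edges labeled by $I_{\mathrm{uf}}$, distinct at each vertex. A seed pattern $\boldsymbol s$ assigns to each vertex $t$ a lattice $N^{(t)}=\bigoplus_{i\in I}\mathbb Ze_i^{(t)}$ and a skew-symmetric integer matrix $B^{(t)}=(b_{ij})_{i,j\in I}$ so that across an edge labeled $k$: $b'_{ij}=-b_{ij}$ if $k\in\{i,j\}$, else $b'_{ij}=b_{ij}+[b_{ik}]_+[b_{kj}]_+-[-b_{ik}]_+[-b_{kj}]_+$. Let $\mathfrak S_I:=\mathfrak S_{I_{\mathrm{uf}}}\times\mathfrak S_{I_{\mathrm f}}$ and let $\mathbb E_I$ be the graph with vertices $(t,\sigma)$, $\sigma\in\mathfrak S_I$; horizontal edges $(t,\sigma)\,\text{—}\,(t',\sigma)$ labeled $\sigma(k)$ for each edge $t\,\text{—}\,t'$ labeled $k$; vertical edges $(t,\sigma)\,\text{—}\,(t,(i\,j)\sigma)$ labeled by transpositions $(i\,j)\in\mathfrak S_I$. Put $b^{(t,\sigma)}_{\sigma(i)\sigma(j)}=b^{(t)}_{ij}$. To each vertex attach tori $\mathcal A$ with coordinates $(A_i)_{i\in I}$ and $\mathcal X^{\mathrm{uf}}$ with coordinates $(X_i)_{i\in I_{\mathrm{uf}}}$; a horizontal edge labeled $k$ gives $\mu_k^*A_k'=A_k^{-1}(\prod_jA_j^{[b_{kj}]_+}+\prod_jA_j^{[-b_{kj}]_+})$,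 $\mu_k^*A_i'=A_i$ ($i\neq k$), $\mu_k^*X'_k=X_k^{-1}$, $\mu_k^*X_i'=X_i(1+X_k^{-\mathrm{sgn}(b_{ik})})^{-b_{ik}}$ ($i\ne k$); vertical edges give permutations of coordinates. $\mu_\gamma$ is the composite along a path $\gamma$. Vertices with equal $B$-matrices are called $\boldsymbol s$-equivalent, and then their tori are identified coordinatewise (seed isomorphism); they are trivially equivalent if moreover for some path $\gamma$ between them $\mu_\gamma$ followed by the seed isomorphism is the identity on both $\mathcal A$ and $\mathcal X^{\mathrm{uf}}$. $\mathbb{E}\mathrm{xch}_{\boldsymbol s}$ is the quotient of $\mathbb E_I$ by trivial equivalence, and $\mathrm{Exch}_{\boldsymbol s}$ the graph obtained by further forgetting labelings. Paths $\gamma_1,\gamma_2$ in $\mathbb{E}\mathrm{xch}_{\boldsymbol s}$, each joining $\boldsymbol s$-equivalent vertices, are $\boldsymbol s$-equivalent if some path $\delta$ between their initial vertices conjugates the induced self-maps ($\mu_{\gamma_\nu}$ followed by the seed isomorphism) into each other, for $\mathcal A$ and $\mathcal X^{\mathrm{uf}}$. A mutation loop is an equivalence class $[\gamma]_{\boldsymbol s}$; mutation loops form the cluster modular group $\Gamma_{\boldsymbol s}$ under concatenation. **Tropical variety and signs.** $\mathcal X^{\mathrm{uf}}_{\boldsymbol s}(\mathbb R^{\mathrm{trop}})$ is the PL manifold with a global chart $(x_i^{(v)})_{i\in I_{\mathrm{uf}}}$ to $\mathbb R^{I_{\mathrm{uf}}}$ for each vertex $v$ of $\mathbb{E}\mathrm{xch}_{\boldsymbol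 s}$, related along a horizontal edge labeled $k$ by $x'_k=-x_k$, $x_i'=x_i+[\mathrm{sgn}(x_k)b_{ik}]_+x_k$ ($i\neq k$), and by permutations along vertical edges. $\mathbb R_{>0}$ acts by scaling and $\Gamma_{\boldsymbol s}$ acts by PL maps: $\phi=[\gamma]_{\boldsymbol s}$, $\gamma:v_0\to v$, is given in the chart $v_0$ by the composite of these along $\gamma$ followed by the coordinatewise identification of charts $v$ and $v_0$. If the horizontal edges of $\gamma$ are labeled in order $k_0,\dots,k_{h-1}$, the $\nu$-th starting at $u_\nu$, the sign of $\gamma$ at $w$ is $\boldsymbol\epsilon_\gamma(w)=(\mathrm{sgn}\,x_{k_\nu}^{(u_\nu)}(w))_\nu\in\{+,0,-\}^h$. $\gamma$ is sign-stable on an $\mathbb R_{>0}$-invariant $\Omega$ if there is $\boldsymbol\epsilon^{\mathrm{stab}}_{\gamma,\Omega}\in\{+,-\}^h$ such that each $w\in\Omega\setminus\{0\}$ satisfies $\boldsymbol\epsilon_\gamma(\phi^n(w))=\boldsymbol\epsilon^{\mathrm{stab}}_{\gamma,\Omega}$ for all sufficiently large $n$. Then $E^{(v_0)}_{\phi,\Omega}$ is the matrix of the linear map obtained from the coordinate expression of $\phi$ in the chart $v_0$ by replacing $\mathrm{sgn}(x_{k_\nu})$ by the $\nu$-th entry of the stable sign at the $\nu$-th horizontal edge. **Cluster reduction.** $\Delta^{\mathrm{FZ}}_{\boldsymbol s}$ is the simplicial complex whose vertices are the cluster variables $A_i^{(v;v_0)}=\mu_\gamma^*A_i^{(v)}$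 ($i\in I_{\mathrm{uf}}$, $\gamma:v_0\to v$) and whose maximal simplices are the clusters $\{A_i^{(v;v_0)}\}_{i\in I_{\mathrm{uf}}}$, $v\in\mathrm{Exch}_{\boldsymbol s}$; its dual graph is $\mathrm{Exch}_{\boldsymbol s}$. For a simplex $S$, $\mathsf G$ is the subgraph of $\mathrm{Exch}_{\boldsymbol s}$ dual to the star of $S$ (vertices: clusters containing $S$). Choose a vertex $v_0$ of $\mathsf G$ with a labeling, so that $S$ corresponds to $K\subset I_{\mathrm{uf}}$; put $J_{\mathrm{uf}}=I_{\mathrm{uf}}\setminus K$, $J_{\mathrm f}=K\cup I_{\mathrm f}$, $J=J_{\mathrm{uf}}\sqcup J_{\mathrm f}$. $\boldsymbol s|_{\mathsf G}$ is the seed pattern with index set $J$ (i.e. with $K$ frozen) having the same initial seed; its exchange graph is $\mathsf G$. $\mathbb E_I^J\subset\mathbb E_I$ is the subgraph keeping only horizontal edges labeled by $J_{\mathrm{uf}}$ and vertical edges labeled by transpositions preserving the decomposition $I=J_{\mathrm{uf}}\sqcup K\sqcup I_{\mathrm f}$; it is also a subgraph of $\mathbb E_J$. A path is contained in $\mathsf G$ when it comes from a path in $\mathbb E_I^J$; regarded as a path for $\boldsymbol s|_{\mathsf G}$, it is denoted $\pi_{\mathsf G}(\gamma)$. $\Gamma^{\mathsf G}_{\boldsymbol s}$ is the subgroup of mutation loops admitting a representation path in $\mathbb E_I^J$, and $\pi_{\mathsf G}:\Gamma^{\mathsf G}_{\boldsymbol s}\to\Gamma_{\boldsymbol s|_{\mathsf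 G}}$ sends $[\gamma]_{\boldsymbol s}$ to $[\pi_{\mathsf G}(\gamma)]_{\boldsymbol s|_{\mathsf G}}$. The surjection $\pi_{\mathsf G}:\mathcal X^{\mathrm{uf}}_{\boldsymbol s}(\mathbb R^{\mathrm{trop}})\to\mathcal X^{\mathrm{uf}}_{\boldsymbol s|_{\mathsf G}}(\mathbb R^{\mathrm{trop}})$ is $(x_i)_{i\in I_{\mathrm{uf}}}\mapsto(x_j)_{j\in J_{\mathrm{uf}}}$ in every chart belonging to $\mathsf G$.
   Formalization: The equality of spectral radii is asserted only when S is not a maximal simplex (J_uf nonempty); otherwise the reduced matrix is 0×0 with undefined spectral radius, while the other is a permutation matrix of spectral radius 1. *)

theory Defs
  imports
    "HOL-Combinatorics.Permutations"
    "HOL-Library.Poly_Mapping"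
    "HOL-Library.Countable_Set"
    "HOL-Computational_Algebra.Fraction_Field"
    "Jordan_Normal_Form.Spectral_Radius"
begin

section \<open>Seed patterns\<close>

text \<open>
  The regular tree with edges labelled by \<open>U\<close> is realised as the set of words over \<open>U\<close> without
  two equal consecutive letters; the edge labelled \<open>k\<close> at \<open>t\<close> joins \<open>t\<close> to \<open>tree_nbr k t\<close>.
\<close>

definition tree :: "'i set \<Rightarrow> 'i list set" where
  "tree U = {t. set t \<subseteq> U \<and> distinct_adj t}"

fun tree_nbr :: "'i \<Rightarrow> 'i list \<Rightarrow> 'i list" where
  "tree_nbr k [] = [k]"
| "tree_nbr k (l # t) = (if l = k then t else k # l # t)"

text \<open>
  The lattice at a tree vertex is the free lattice on the index set with its standard basis, so a
  seed pattern is given by its exchange matrices. Entries with an index outside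
  \<open>unfrozen s \<union> frozen s\<close> are irrelevant.
\<close>

record 'i seed_data =
  unfrozen :: "'i set"
  frozen :: "'i set"
  exmat :: "'i list \<Rightarrow> 'i \<Rightarrow> 'i \<Rightarrow> int"

definition indices :: "'i seed_data \<Rightarrow> 'i set" where
  "indices s = unfrozen s \<union> frozen s"

definition mat_mutation :: "'i \<Rightarrow> ('i \<Rightarrow> 'i \<Rightarrow> int) \<Rightarrow> 'i \<Rightarrow> 'i \<Rightarrow> int" where
  "mat_mutation k b i j =
     (if i = k \<or> j = k then - b i j
      else b i j + max (b i k) 0 * max (b k j) 0 - max (- b i k) 0 * max (- b k j) 0)"

definition seed_pattern :: "'i seed_data \<Rightarrow> bool" where
  "seed_pattern s \<longleftrightarrow>
     finite (unfrozen s) \<and> finite (frozen s) \<and> unfrozen s \<inter> frozen s = {} \<and>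
     (\<forall>t\<in>tree (unfrozen s). \<forall>i\<in>indices s. \<forall>j\<in>indices s. exmat s t j i = - exmat s t i j) \<and>
     (\<forall>t\<in>tree (unfrozen s). \<forall>k\<in>unfrozen s. \<forall>i\<in>indices s. \<forall>j\<in>indices s.
        exmat s (tree_nbr k t) i j = mat_mutation k (exmat s t) i j)"


section \<open>The labelled exchange graph and its paths\<close>

definition labelings :: "'i seed_data \<Rightarrow> ('i \<Rightarrow> 'i) set" where
  "labelings s = {\<sigma>. \<sigma> permutes indices s \<and> \<sigma> ` unfrozen s = unfrozen s}"

type_synonym 'i vtx = "'i list \<times> ('i \<Rightarrow> 'i)"

definition verts :: "'i seed_data \<Rightarrow> 'i vtx set" where
  "verts s = tree (unfrozen s) \<times> labelings s"

definition bmat :: "'i seed_data \<Rightarrow> 'i vtx \<Rightarrow> 'i \<Rightarrow> 'i \<Rightarrow> int" where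
  "bmat s v i j = exmat s (fst v) (inv_into UNIV (snd v) i) (inv_into UNIV (snd v) j)"

text \<open>
  Edge labels: \<open>Hor k\<close> for horizontal edges and \<open>Ver i j\<close> for vertical edges labelled by the
  transposition of \<open>i\<close> and \<open>j\<close>. Every vertex has exactly one edge for each label, so a path is
  given by its initial vertex and the list of the labels it traverses.
\<close>

datatype 'i move = Hor 'i | Ver 'i 'i

definition moves :: "'i seed_data \<Rightarrow> 'i move set" where
  "moves s = Hor ` unfrozen s
     \<union> {Ver i j | i j. i \<noteq> j \<and> Transposition.transpose i j \<in> labelings s}"

fun step :: "'i vtx \<Rightarrow> 'i move \<Rightarrow> 'i vtx" where
  "step (t, \<sigma>) (Hor k) = (tree_nbr (inv_into UNIV \<sigma> k) t, \<sigma>)"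
| "step (t, \<sigma>) (Ver i j) = (t, Transposition.transpose i j \<circ> \<sigma>)"

type_synonym 'i epath = "'i vtx \<times> 'i move list"

definition epath :: "'i seed_data \<Rightarrow> 'i epath \<Rightarrow> bool" where
  "epath s \<gamma> \<longleftrightarrow> fst \<gamma> \<in> verts s \<and> set (snd \<gamma>) \<subseteq> moves s"

definition target :: "'i epath \<Rightarrow> 'i vtx" where
  "target \<gamma> = foldl step (fst \<gamma>) (snd \<gamma>)"


section \<open>Cluster transformations\<close>

text \<open>
  Coordinates are allowed to take values in an arbitrary field. Evaluating \<open>\<mu>\<^sub>\<gamma>\<close> at the generic
  point, i.e. at the tuple of indeterminates of the field of rational functions on the initial
  torus, yields the pullbacks \<open>\<mu>\<^sub>\<gamma>\<^sup>* A\<^sub>i\<close> and \<open>\<mu>\<^sub>\<gamma>\<^sup>* X\<^sub>i\<close> of the coordinates at the end of \<open>\<gamma>\<close>.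
\<close>

fun A_map :: "'i set \<Rightarrow> ('i \<Rightarrow> 'i \<Rightarrow> int) \<Rightarrow> 'i move \<Rightarrow> ('i \<Rightarrow> 'f::field) \<Rightarrow> 'i \<Rightarrow> 'f" where
  "A_map I b (Hor k) A =
     A(k := inverse (A k) * ((\<Prod>j\<in>I. A j ^ nat (max (b k j) 0)) + (\<Prod>j\<in>I. A j ^ nat (max (- b k j) 0))))"
| "A_map I b (Ver i j) A = (\<lambda>l. A (Transposition.transpose i j l))"

fun X_map :: "('i \<Rightarrow> 'i \<Rightarrow> int) \<Rightarrow> 'i move \<Rightarrow> ('i \<Rightarrow> 'f::field) \<Rightarrow> 'i \<Rightarrow> 'f" where
  "X_map b (Hor k) X =
     (\<lambda>i. if i = k then inverse (X k)
          else X i * (1 + X k powi (- sgn (b i k))) powi (- b i k))"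
| "X_map b (Ver i j) X = (\<lambda>l. X (Transposition.transpose i j l))"

fun A_along :: "'i seed_data \<Rightarrow> 'i vtx \<Rightarrow> 'i move list \<Rightarrow> ('i \<Rightarrow> 'f::field) \<Rightarrow> 'i \<Rightarrow> 'f" where
  "A_along s v [] A = A"
| "A_along s v (a # p) A = A_along s (step v a) p (A_map (indices s) (bmat s v) a A)"

fun X_along :: "'i seed_data \<Rightarrow> 'i vtx \<Rightarrow> 'i move list \<Rightarrow> ('i \<Rightarrow> 'f::field) \<Rightarrow> 'i \<Rightarrow> 'f" where
  "X_along s v [] X = X"
| "X_along s v (a # p) X = X_along s (step v a) p (X_map (bmat s v) a X)"

text \<open>
  The index type is linearly ordered only because the library shows polynomials
  over \<open>'i\<close> to be an integral domain under this assumption.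
\<close>

type_synonym 'i ratfun = "(('i \<Rightarrow>\<^sub>0 nat) \<Rightarrow>\<^sub>0 rat) fract"

definition indet :: "'i::linorder \<Rightarrow> 'i ratfun" where
  "indet i = Fract (Poly_Mapping.single (Poly_Mapping.single i 1) 1) 1"


section \<open>Mutation loops\<close>

definition seed_equiv :: "'i seed_data \<Rightarrow> 'i vtx \<Rightarrow> 'i vtx \<Rightarrow> bool" where
  "seed_equiv s v v' \<longleftrightarrow> (\<forall>i\<in>indices s. \<forall>j\<in>indices s. bmat s v i j = bmat s v' i j)"

definition loop_path :: "'i seed_data \<Rightarrow> 'i epath \<Rightarrow> bool" where
  "loop_path s \<gamma> \<longleftrightarrow> epath s \<gamma> \<and> seed_equiv s (fst \<gamma>) (target \<gamma>)"

text \<open>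
  For a path \<open>\<gamma>\<close> joining equivalent vertices, the coordinatewise identification of the two tori
  turns \<open>A_along\<close> and \<open>X_along\<close> into self-maps. The identities below are required at the
  generic point of the torus at \<open>fst \<gamma>1\<close>. It suffices to consider paths in the labelled graph before
  taking the quotient by trivial equivalence: paths lift, and a lift may be prolonged by a
  path with trivial cluster transformations so as to reach any representative of its end.
\<close>

definition path_equiv :: "'i::linorder seed_data \<Rightarrow> 'i epath \<Rightarrow> 'i epath \<Rightarrow> bool" where
  "path_equiv s \<gamma>1 \<gamma>2 \<longleftrightarrow> (\<exists>\<delta>. epath s (fst \<gamma>1, \<delta>) \<and> target (fst \<gamma>1, \<delta>) = fst \<gamma>2 \<and>
     (\<forall>i\<in>indices s.
        A_along s (fst \<gamma>1) \<delta> (A_along s (fst \<gamma>1) (snd \<gamma>1) indet) i =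
        A_along s (fst \<gamma>2) (snd \<gamma>2) (A_along s (fst \<gamma>1) \<delta> indet) i) \<and>
     (\<forall>i\<in>unfrozen s.
        X_along s (fst \<gamma>1) \<delta> (X_along s (fst \<gamma>1) (snd \<gamma>1) indet) i =
        X_along s (fst \<gamma>2) (snd \<gamma>2) (X_along s (fst \<gamma>1) \<delta> indet) i))"

definition mutation_loop :: "'i::linorder seed_data \<Rightarrow> 'i epath \<Rightarrow> 'i epath set" where
  "mutation_loop s \<gamma> = {\<gamma>'. loop_path s \<gamma>' \<and> path_equiv s \<gamma> \<gamma>'}"

definition cluster_modular_group :: "'i::linorder seed_data \<Rightarrow> 'i epath set set" where
  "cluster_modular_group s = {mutation_loop s \<gamma> | \<gamma>. loop_path s \<gamma>}"


section \<open>The tropical variety and sign stability\<close>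

fun sgn_mutation :: "('i \<Rightarrow> 'i \<Rightarrow> int) \<Rightarrow> 'i \<Rightarrow> real \<Rightarrow> ('i \<Rightarrow> real) \<Rightarrow> 'i \<Rightarrow> real" where
  "sgn_mutation b k e x =
     (\<lambda>i. if i = k then - x k else x i + max (e * of_int (b i k)) 0 * x k)"

fun trop_map :: "('i \<Rightarrow> 'i \<Rightarrow> int) \<Rightarrow> 'i move \<Rightarrow> ('i \<Rightarrow> real) \<Rightarrow> 'i \<Rightarrow> real" where
  "trop_map b (Hor k) x = sgn_mutation b k (sgn (x k)) x"
| "trop_map b (Ver i j) x = (\<lambda>l. x (Transposition.transpose i j l))"

text \<open>
  A point of the tropical variety is the family of its coordinate vectors in all charts,
  \<open>w v i\<close> being the \<open>i\<close>-th coordinate in the chart \<open>v\<close>. Values at meaningless arguments are 0, so that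
  equality of points is equality of functions.
\<close>

type_synonym 'i trop_point = "'i vtx \<Rightarrow> 'i \<Rightarrow> real"

definition trop_variety :: "'i seed_data \<Rightarrow> 'i trop_point set" where
  "trop_variety s = {w.
     (\<forall>v i. v \<notin> verts s \<or> i \<notin> unfrozen s \<longrightarrow> w v i = 0) \<and>
     (\<forall>v\<in>verts s. \<forall>a\<in>moves s. \<forall>i\<in>unfrozen s. w (step v a) i = trop_map (bmat s v) a (w v) i)}"

definition trop_zero :: "'i trop_point" where
  "trop_zero = (\<lambda>v i. 0)"

definition trop_scale :: "real \<Rightarrow> 'i trop_point \<Rightarrow> 'i trop_point" where
  "trop_scale c w = (\<lambda>v i. c * w v i)"

definition scaling_invariant :: "'i trop_point set \<Rightarrow> bool" where
  "scaling_invariant \<Omega> \<longleftrightarrow> (\<forall>c>0. \<forall>w\<in>\<Omega>. trop_scale c w \<in> \<Omega>)"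

text \<open>
  The action of the mutation loop represented by \<open>\<gamma>\<close>: the coordinates of the image in the chart at the
  initial vertex are the coordinates of \<open>w\<close> in the chart at the terminal vertex.
\<close>

definition trop_act :: "'i seed_data \<Rightarrow> 'i epath \<Rightarrow> 'i trop_point \<Rightarrow> 'i trop_point" where
  "trop_act s \<gamma> w = (THE w'. w' \<in> trop_variety s \<and> w' (fst \<gamma>) = w (target \<gamma>))"

fun signs_along :: "'i vtx \<Rightarrow> 'i move list \<Rightarrow> 'i trop_point \<Rightarrow> real list" where
  "signs_along v [] w = []"
| "signs_along v (Hor k # p) w = sgn (w v k) # signs_along (step v (Hor k)) p w"
| "signs_along v (Ver i j # p) w = signs_along (step v (Ver i j)) p w"

definition sign_of_path :: "'i epath \<Rightarrow> 'i trop_point \<Rightarrow> real list" where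
  "sign_of_path \<gamma> w = signs_along (fst \<gamma>) (snd \<gamma>) w"

definition hor_length :: "'i epath \<Rightarrow> nat" where
  "hor_length \<gamma> = length (filter (\<lambda>a. \<exists>k. a = Hor k) (snd \<gamma>))"

definition is_stable_sign :: "'i seed_data \<Rightarrow> 'i epath \<Rightarrow> 'i trop_point set \<Rightarrow> real list \<Rightarrow> bool" where
  "is_stable_sign s \<gamma> \<Omega> \<epsilon> \<longleftrightarrow> length \<epsilon> = hor_length \<gamma> \<and> set \<epsilon> \<subseteq> {1, -1} \<and>
     (\<forall>w\<in>\<Omega> - {trop_zero}. \<exists>n0. \<forall>n\<ge>n0. sign_of_path \<gamma> ((trop_act s \<gamma> ^^ n) w) = \<epsilon>)"

definition sign_stable :: "'i seed_data \<Rightarrow> 'i epath \<Rightarrow> 'i trop_point set \<Rightarrow> bool" where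
  "sign_stable s \<gamma> \<Omega> \<longleftrightarrow> (\<exists>\<epsilon>. is_stable_sign s \<gamma> \<Omega> \<epsilon>)"

text \<open>Unique whenever \<open>\<Omega>\<close> contains a nonzero point; otherwise an arbitrary tuple of signs.\<close>

definition stable_sign :: "'i seed_data \<Rightarrow> 'i epath \<Rightarrow> 'i trop_point set \<Rightarrow> real list" where
  "stable_sign s \<gamma> \<Omega> = (SOME \<epsilon>. is_stable_sign s \<gamma> \<Omega> \<epsilon>)"

fun presentation :: "'i seed_data \<Rightarrow> 'i vtx \<Rightarrow> 'i move list \<Rightarrow> real list \<Rightarrow> ('i \<Rightarrow> real) \<Rightarrow> 'i \<Rightarrow> real" where
  "presentation s v [] \<epsilon> x = x"
| "presentation s v (Hor k # p) \<epsilon> x =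
     presentation s (step v (Hor k)) p (tl \<epsilon>) (sgn_mutation (bmat s v) k (hd \<epsilon>) x)"
| "presentation s v (Ver i j # p) \<epsilon> x =
     presentation s (step v (Ver i j)) p \<epsilon> (\<lambda>l. x (Transposition.transpose i j l))"

text \<open>
  The presentation matrix in the chart at the initial vertex. The library's matrices are indexed by
  initial segments of the naturals, so the unfrozen indices are enumerated
  by the (arbitrary but fixed) bijection \<open>from_nat_into (unfrozen s)\<close>.
\<close>

definition presentation_matrix :: "'i seed_data \<Rightarrow> 'i epath \<Rightarrow> 'i trop_point set \<Rightarrow> complex mat" where
  "presentation_matrix s \<gamma> \<Omega> =
     (let n = card (unfrozen s); idx = from_nat_into (unfrozen s) in
      mat n n (\<lambda>(r, c). complex_of_real
        (presentation s (fst \<gamma>) (snd \<gamma>) (stable_sign s \<gamma> \<Omega>)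
           (\<lambda>i. if i = idx c then 1 else 0) (idx r))))"


section \<open>The cluster complex and cluster reduction\<close>

text \<open>
  The cluster variable \<open>A\<^sub>i\<^sup>(\<^sup>v\<^sup>;\<^sup>r\<^sup>)\<close> as a rational function on the torus at \<open>r\<close>. It does not depend on
  the path from \<open>r\<close> to \<open>v\<close> used to compute it.
\<close>

definition cluster_var :: "'i::linorder seed_data \<Rightarrow> 'i vtx \<Rightarrow> 'i vtx \<Rightarrow> 'i \<Rightarrow> 'i ratfun" where
  "cluster_var s r v i =
     A_along s r (SOME p. epath s (r, p) \<and> target (r, p) = v) indet i"

definition cluster :: "'i::linorder seed_data \<Rightarrow> 'i vtx \<Rightarrow> 'i vtx \<Rightarrow> 'i ratfun set" where
  "cluster s r v = cluster_var s r v ` unfrozen s"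

definition FZ_complex :: "'i::linorder seed_data \<Rightarrow> 'i vtx \<Rightarrow> 'i ratfun set set" where
  "FZ_complex s r = {S. \<exists>v\<in>verts s. S \<subseteq> cluster s r v}"

text \<open>The vertices of the dual graph of the star of \<open>S\<close>.\<close>

definition star_clusters :: "'i::linorder seed_data \<Rightarrow> 'i vtx \<Rightarrow> 'i ratfun set \<Rightarrow> 'i ratfun set set" where
  "star_clusters s r S = {C. (\<exists>v\<in>verts s. C = cluster s r v) \<and> S \<subseteq> C}"

definition simplex_labels :: "'i::linorder seed_data \<Rightarrow> 'i vtx \<Rightarrow> 'i ratfun set \<Rightarrow> 'i vtx \<Rightarrow> 'i set" where
  "simplex_labels s r S v0 = {i \<in> unfrozen s. cluster_var s r v0 i \<in> S}"

fun mutate_word :: "('i \<Rightarrow> 'i \<Rightarrow> int) \<Rightarrow> 'i list \<Rightarrow> 'i \<Rightarrow> 'i \<Rightarrow> int" where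
  "mutate_word b [] = b"
| "mutate_word b (k # t) = mat_mutation k (mutate_word b t)"

text \<open>
  Freezing the labels \<open>K\<close> of the seed at \<open>v0\<close>. The resulting pattern lives on the
  tree with fewer labels, rebased so that \<open>v0\<close> becomes the vertex \<open>base_vtx\<close>.
\<close>

definition base_vtx :: "'i vtx" where
  "base_vtx = ([], id)"

definition reduced_pattern :: "'i seed_data \<Rightarrow> 'i vtx \<Rightarrow> 'i set \<Rightarrow> 'i seed_data" where
  "reduced_pattern s v0 K =
     \<lparr> unfrozen = unfrozen s - K, frozen = K \<union> frozen s, exmat = mutate_word (bmat s v0) \<rparr>"

definition moves_in :: "'i seed_data \<Rightarrow> 'i set \<Rightarrow> 'i move set" where
  "moves_in s K = Hor ` (unfrozen s - K)
     \<union> {Ver i j | i j. i \<noteq> j \<and> Transposition.transpose i j \<in> labelings s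
                     \<and> Transposition.transpose i j ` K = K}"

text \<open>
  Paths in the component of \<open>v0\<close> of the subgraph of the labelled exchange graph given by \<open>moves_in\<close>.
  (In other components the labels \<open>K\<close> belong to other simplices.)
\<close>

definition path_in :: "'i seed_data \<Rightarrow> 'i vtx \<Rightarrow> 'i set \<Rightarrow> 'i epath \<Rightarrow> bool" where
  "path_in s v0 K \<gamma> \<longleftrightarrow>
     (\<exists>q. set q \<subseteq> moves_in s K \<and> fst \<gamma> = target (v0, q)) \<and> set (snd \<gamma>) \<subseteq> moves_in s K"

definition reduced_loops :: "'i::linorder seed_data \<Rightarrow> 'i vtx \<Rightarrow> 'i set \<Rightarrow> 'i epath set set" where
  "reduced_loops s v0 K = {\<phi> \<in> cluster_modular_group s. \<exists>\<gamma>\<in>\<phi>. path_in s v0 K \<gamma>}"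

text \<open>The path of the reduced pattern given by a path from \<open>v0\<close> with edge labels \<open>p\<close>.\<close>

definition reduced_path :: "'i move list \<Rightarrow> 'i epath" where
  "reduced_path p = (base_vtx, p)"

text \<open>
  Forgetting the coordinates in \<open>K\<close> in all charts at vertices \<open>target (v0, q)\<close>, the corresponding
  vertex for the reduced pattern being \<open>target (reduced_path q)\<close>.
\<close>

definition reduction_map :: "'i seed_data \<Rightarrow> 'i vtx \<Rightarrow> 'i set \<Rightarrow> 'i trop_point \<Rightarrow> 'i trop_point" where
  "reduction_map s v0 K w = (THE w'. w' \<in> trop_variety (reduced_pattern s v0 K) \<and>
     (\<forall>q. set q \<subseteq> moves_in s K \<longrightarrow>
        (\<forall>j\<in>unfrozen s - K. w' (target (reduced_path q)) j = w (target (v0, q)) j)))"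

end

(* Frozen coordinates never influence the unfrozen ones, so the coordinates outside K evolve along the
   path exactly as for the reduced pattern: reduction intertwines the two actions on the tropical
   varieties and preserves signs, and it is onto because a point of a tropical variety is
   given by arbitrary coordinates in one chart. Hence the same tuples of signs are stable on both sides.

   For a stable sign the presentation matrix is block triangular with respect to the labels outside K
   and those in K. The first block is the reduced presentation matrix, the second one a permutation
   matrix, whose eigenvalues have modulus 1. As the reduced matrix is invertible with
   integer entries, its spectral radius is at least 1, and the second block does not matter. *)

theory Submission
  imports Defs
begin

section \<open>Spectral radius of matrices indexed by a finite set\<close>

text \<open>The enumeration is the one in \<open>presentation_matrix\<close>, so presentation
  matrices are instances, while eigenvector equations become sums over \<open>U\<close> without any
  ordering.\<close>

definition index_mat :: "'i set \<Rightarrow> ('i \<Rightarrow> 'i \<Rightarrow> 'a) \<Rightarrow> 'a mat" where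
  "index_mat U L = mat (card U) (card U) (\<lambda>(r, c). L (from_nat_into U r) (from_nat_into U c))"

lemma index_mat_carrier [simp]: "index_mat U L \<in> carrier_mat (card U) (card U)"
  by (simp add: index_mat_def)

lemma transpose_index_mat: "transpose_mat (index_mat U L) = index_mat U (\<lambda>i j. L j i)"
  by (auto simp: index_mat_def)

lemma from_nat_into_less_card: "finite U \<Longrightarrow> r < card U \<Longrightarrow> from_nat_into U r \<in> U"
  by (rule from_nat_into) auto

lemma index_mat_cong:
  assumes "finite U" and "\<And>i j. i \<in> U \<Longrightarrow> j \<in> U \<Longrightarrow> L i j = L' i j"
  shows "index_mat U L = index_mat U L'"
  using assms by (auto simp: index_mat_def from_nat_into_less_card intro!: eq_matI)

lemma index_mat_mult_vec:
  fixes L :: "'i \<Rightarrow> 'i \<Rightarrow> 'a::comm_ring_1"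
  assumes "finite U"
  shows "index_mat U L *\<^sub>v vec (card U) (\<lambda>r. x (from_nat_into U r))
    = vec (card U) (\<lambda>r. \<Sum>c\<in>U. L (from_nat_into U r) c * x c)"
proof (rule eq_vecI)
  fix r assume "r < dim_vec (vec (card U) (\<lambda>r. \<Sum>c\<in>U. L (from_nat_into U r) c * x c))"
  then have r: "r < card U" by simp
  have "(index_mat U L *\<^sub>v vec (card U) (\<lambda>r. x (from_nat_into U r))) $ r
    = (\<Sum>c\<in>{..<card U}. L (from_nat_into U r) (from_nat_into U c) * x (from_nat_into U c))"
    using r by (simp add: index_mat_def scalar_prod_def atLeast0LessThan)
  also have "\<dots> = (\<Sum>c\<in>U. L (from_nat_into U r) c * x c)"
    by (rule sum.reindex_bij_betw[OF bij_betw_from_nat_into_finite[OF assms]])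
  finally show "(index_mat U L *\<^sub>v vec (card U) (\<lambda>r. x (from_nat_into U r))) $ r
    = vec (card U) (\<lambda>r. \<Sum>c\<in>U. L (from_nat_into U r) c * x c) $ r"
    using r by simp
qed (simp add: index_mat_def)

text \<open>Vectors become functions through the bijection \<open>from_nat_into U\<close>. Their
  values outside \<open>U\<close> are meaningless, so nonvanishing is demanded on
  \<open>U\<close>.\<close>

lemma eigenvalue_index_mat:
  fixes L :: "'i \<Rightarrow> 'i \<Rightarrow> 'a::comm_ring_1"
  assumes "finite U"
  shows "eigenvalue (index_mat U L) l \<longleftrightarrow>
    (\<exists>x. (\<exists>i\<in>U. x i \<noteq> 0) \<and> (\<forall>i\<in>U. (\<Sum>c\<in>U. L i c * x c) = l * x i))"
    (is "_ \<longleftrightarrow> ?R")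
proof
  have onto: "\<exists>r<card U. i = from_nat_into U r" if "i \<in> U" for i
    using bij_betw_from_nat_into_finite[OF assms] that unfolding bij_betw_def by blast
  assume "eigenvalue (index_mat U L) l"
  then obtain v where v: "v \<in> carrier_vec (card U)" "v \<noteq> 0\<^sub>v (card U)"
    "index_mat U L *\<^sub>v v = l \<cdot>\<^sub>v v"
    unfolding eigenvalue_def eigenvector_def by (auto simp: index_mat_def)
  \<comment> \<open>\<open>to_nat_on U\<close> inverts the enumeration behind
    \<open>index_mat\<close>.\<close>
  define x where "x i = v $ to_nat_on U i" for i
  have x: "x (from_nat_into U r) = v $ r" if "r < card U" for r
    using assms that to_nat_on_finite[OF assms] unfolding x_def
    by (simp add: to_nat_on_from_nat_into bij_betw_imp_surj_on countable_finite)
  have veq: "v = vec (card U) (\<lambda>r. x (from_nat_into U r))"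
    using v(1) by (auto simp: x)
  obtain r where r: "r < card U" "v $ r \<noteq> 0"
    using v(1,2) by (metis carrier_vecD eq_vecI index_zero_vec)
  have "\<exists>i\<in>U. x i \<noteq> 0"
    using r x[OF r(1)] by (intro bexI[of _ "from_nat_into U r"] from_nat_into_less_card assms) auto
  moreover have "(\<Sum>c\<in>U. L i c * x c) = l * x i" if i: "i \<in> U" for i
  proof -
    obtain r where r: "r < card U" "i = from_nat_into U r" using onto[OF i] by blast
    have "vec (card U) (\<lambda>r. \<Sum>c\<in>U. L (from_nat_into U r) c * x c) $ r = (l \<cdot>\<^sub>v v) $ r"
      using v(3) index_mat_mult_vec[OF assms, of L x] veq by simp
    then show ?thesis using r v(1) by (simp add: x)
  qed
  ultimately show ?R by blast
next
  have onto: "\<exists>r<card U. i = from_nat_into U r" if "i \<in> U" for i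
    using bij_betw_from_nat_into_finite[OF assms] that unfolding bij_betw_def by blast
  assume ?R
  then obtain x j where x: "j \<in> U" "x j \<noteq> 0" "\<And>i. i \<in> U \<Longrightarrow> (\<Sum>c\<in>U. L i c * x c) = l * x i"
    by blast
  let ?v = "vec (card U) (\<lambda>r. x (from_nat_into U r))"
  have "?v \<noteq> 0\<^sub>v (card U)"
  proof
    assume *: "?v = 0\<^sub>v (card U)"
    obtain r where "r < card U" "j = from_nat_into U r" using onto[OF x(1)] by blast
    then show False using arg_cong[OF *, of "\<lambda>v. v $ r"] x(2) by simp
  qed
  moreover have "index_mat U L *\<^sub>v ?v = l \<cdot>\<^sub>v ?v"
    unfolding index_mat_mult_vec[OF assms] using x(3) from_nat_into_less_card[OF assms] by auto
  ultimately show "eigenvalue (index_mat U L) l"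
    unfolding eigenvalue_def eigenvector_def by (intro exI[of _ ?v]) (auto simp: index_mat_def)
qed

text \<open>A matrix and its transpose have the same characteristic polynomial, so left eigenvectors
  detect the same eigenvalues.\<close>

lemma eigenvalue_index_mat_left:
  fixes L :: "'i \<Rightarrow> 'i \<Rightarrow> 'a::field"
  assumes "finite U"
  shows "eigenvalue (index_mat U L) l \<longleftrightarrow>
    (\<exists>x. (\<exists>i\<in>U. x i \<noteq> 0) \<and> (\<forall>j\<in>U. (\<Sum>c\<in>U. L c j * x c) = l * x j))"
proof -
  have "eigenvalue (index_mat U L) l \<longleftrightarrow> eigenvalue (transpose_mat (index_mat U L)) l"
    using eigenvalue_root_char_poly[OF index_mat_carrier[of U L]]
      eigenvalue_root_char_poly[OF transpose_carrier_mat[THEN iffD2, OF index_mat_carrier[of U L]]]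
      char_poly_transpose_mat[OF index_mat_carrier[of U L]] by simp
  then show ?thesis
    unfolding transpose_index_mat using eigenvalue_index_mat[OF assms, of "\<lambda>i j. L j i" l] by simp
qed

section \<open>Spectral radius of integer and of block triangular matrices\<close>

lemma norm_prod_list_less_1:
  fixes as :: "complex list"
  assumes "as \<noteq> []" and "\<And>a. a \<in> set as \<Longrightarrow> norm a < 1"
  shows "norm (prod_list as) < 1"
  using assms
proof (induction as)
  case (Cons a as)
  \<comment> \<open>Only the weak bound holds for the tail, which may be empty with product
    1.\<close>
  have "norm (prod_list as) \<le> 1"
    using Cons by (cases as) (auto intro: less_imp_le)
  then have "norm a * norm (prod_list as) \<le> norm a" by (simp add: mult_left_le)
  then show ?case using Cons.prems(2)[of a] by (simp add: norm_mult)
qed simp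

text \<open>
  The constant coefficient of the characteristic polynomial is a nonzero integer and, up to sign,
  the product of the eigenvalues.
\<close>

lemma spectral_radius_integer_mat_ge_1:
  fixes L :: "'i \<Rightarrow> 'i \<Rightarrow> complex"
  assumes "finite U" "U \<noteq> {}"
    and int: "\<And>i j. i \<in> U \<Longrightarrow> j \<in> U \<Longrightarrow> L i j \<in> \<int>"
    and inj: "\<And>x i. \<forall>i\<in>U. (\<Sum>c\<in>U. L i c * x c) = 0 \<Longrightarrow> i \<in> U \<Longrightarrow> x i = 0"
  shows "1 \<le> spectral_radius (index_mat U L)"
proof (rule ccontr)
  let ?A = "index_mat U L"
  assume small: "\<not> 1 \<le> spectral_radius ?A"
  have n: "card U > 0" using assms by (simp add: card_gt_0_iff)
  \<comment> \<open>A matrix over the integers is needed for integer coefficients of the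
    characteristic polynomial; the floor of the real part recovers an integer entry.\<close>
  define B where "B = index_mat U (\<lambda>i j. \<lfloor>Re (L i j)\<rfloor>)"
  have "of_int \<lfloor>Re z\<rfloor> = z" if "z \<in> \<int>" for z :: complex
    using that by (auto elim: Ints_cases)
  then have A: "?A = map_mat of_int B"
    using int from_nat_into_less_card[OF assms(1)] unfolding B_def index_mat_def
    by (intro eq_matI) auto
  have "char_poly ?A = map_poly of_int (char_poly B)"
    unfolding A by (rule of_int_hom.char_poly_hom[of _ "card U"]) (simp add: B_def)
  then have c0: "poly (char_poly ?A) 0 = of_int (coeff (char_poly B) 0)"
    by (simp add: poly_0_coeff_0 of_int_hom.coeff_map_poly_hom)
  \<comment> \<open>Injectivity excludes the eigenvalue 0, so the constant coefficient is a nonzero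
    integer.\<close>
  have "\<not> eigenvalue ?A 0"
    unfolding eigenvalue_index_mat[OF assms(1)] using inj by (metis mult_zero_left)
  then have "poly (char_poly ?A) 0 \<noteq> 0"
    using eigenvalue_root_char_poly[OF index_mat_carrier] by blast
  then have ge: "norm (poly (char_poly ?A) 0) \<ge> 1"
    unfolding c0 by (auto simp: norm_of_int)
  obtain as where as: "char_poly ?A = (\<Prod>a\<leftarrow>as. [:- a, 1:])" "length as = card U"
    using char_poly_factorized[OF index_mat_carrier] by blast
  have "norm a < 1" if "a \<in> set as" for a
  proof -
    have "poly (char_poly ?A) a = 0"
      unfolding as(1) poly_prod_list using that by (force simp: prod_list_zero_iff)
    then have "a \<in> spectrum ?A" using spectrum_root_char_poly[OF index_mat_carrier] by blast
    then show ?thesis using spectral_radius_mem_max(2)[OF index_mat_carrier n] small by fastforce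
  qed
  \<comment> \<open>\<open>poly (char_poly ?A) 0\<close> is the product of the negated roots; there
    is at least one root because \<open>U\<close> is nonempty.\<close>
  then have "norm (prod_list (map uminus as)) < 1"
    using as(2) n by (intro norm_prod_list_less_1) auto
  then show False using ge unfolding as(1) by (simp add: poly_prod_list o_def)
qed

text \<open>Right eigenvectors give the upper bound: on \<open>J\<close> they are eigenvectors of
  the \<open>J\<close> block, or they vanish there and belong to the permutation block. Left
  eigenvectors give the lower bound. As \<open>J\<close> is nonempty, both spectral radii are moduli
  of eigenvalues.\<close>

lemma spectral_radius_block_triangular:
  fixes L :: "'i \<Rightarrow> 'i \<Rightarrow> complex"
  assumes fin: "finite U" and J: "J \<subseteq> U" "J \<noteq> {}"
    and zero: "\<And>i c. i \<in> J \<Longrightarrow> c \<in> U - J \<Longrightarrow> L i c = 0"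
    and perm: "\<pi> permutes (U - J)"
      "\<And>i c. i \<in> U - J \<Longrightarrow> c \<in> U - J \<Longrightarrow> L i c = (if c = \<pi> i then 1 else 0)"
    and ge: "1 \<le> spectral_radius (index_mat J L)"
  shows "spectral_radius (index_mat U L) = spectral_radius (index_mat J L)"
proof (rule antisym)
  have finJ: "finite J" using fin J finite_subset by blast
  have nJ: "card J > 0" "card U > 0" using finJ fin J by (auto simp: card_gt_0_iff)
  have split: "sum f U = sum f J + sum f (U - J)" for f :: "'i \<Rightarrow> complex"
    using J(1) fin by (metis add.commute sum.subset_diff)
  obtain l where l: "l \<in> spectrum (index_mat U L)" "spectral_radius (index_mat U L) = norm l"
    using spectral_radius_mem_max(1)[OF index_mat_carrier[of U L] nJ(2)] by blast
  obtain x where x: "\<exists>i\<in>U. x i \<noteq> 0" "\<And>i. i \<in> U \<Longrightarrow> (\<Sum>c\<in>U. L i c * x c) = l * x i"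
    using l(1) unfolding spectrum_def using eigenvalue_index_mat[OF fin, of L l] by auto
  show "spectral_radius (index_mat U L) \<le> spectral_radius (index_mat J L)"
  proof (cases "\<exists>i\<in>J. x i \<noteq> 0")
    case True
    have "(\<Sum>c\<in>J. L i c * x c) = l * x i" if "i \<in> J" for i
      using x(2)[of i] that J zero by (auto simp: split)
    then have "l \<in> spectrum (index_mat J L)"
      unfolding spectrum_def using True by (auto simp: eigenvalue_index_mat[OF finJ])
    then show ?thesis
      using spectral_radius_mem_max(2)[OF index_mat_carrier[of J L] nJ(1)] l(2) by auto
  next
    case False
    \<comment> \<open>As \<open>x\<close> vanishes on \<open>J\<close>, only the permutation block
      acts on it.\<close>
    have eq: "l * x i = x (\<pi> i)" if i: "i \<in> U - J" for i
    proof -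
      have "(\<Sum>c\<in>U. L i c * x c) = (\<Sum>c\<in>U - J. L i c * x c)"
        using False by (simp add: split)
      also have "\<dots> = (\<Sum>c\<in>U - J. if c = \<pi> i then x c else 0)"
        using perm(2)[OF i] by (intro sum.cong) auto
      also have "\<dots> = x (\<pi> i)"
        using permutes_in_image[OF perm(1), of i] i fin by (simp add: sum.delta)
      finally show ?thesis using x(2)[of i] i by simp
    qed
    \<comment> \<open>A permutation preserves the sum of the moduli, which is nonzero, so
      \<open>l\<close> has modulus 1.\<close>
    have "norm l * (\<Sum>i\<in>U - J. norm (x i)) = (\<Sum>i\<in>U - J. norm (x (\<pi> i)))"
      unfolding sum_distrib_left by (intro sum.cong) (auto simp flip: eq norm_mult)
    also have "\<dots> = (\<Sum>i\<in>U - J. norm (x i))"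
      by (rule sum.reindex_bij_betw[OF permutes_imp_bij[OF perm(1)]])
    finally have "norm l * (\<Sum>i\<in>U - J. norm (x i)) = (\<Sum>i\<in>U - J. norm (x i))" .
    moreover have "(\<Sum>i\<in>U - J. norm (x i)) \<noteq> 0"
      using x(1) False fin by (subst sum_nonneg_eq_0_iff) auto
    ultimately have "norm l = 1" by simp
    then show ?thesis using ge l(2) by simp
  qed
next
  have finJ: "finite J" using fin J finite_subset by blast
  have nJ: "card J > 0" "card U > 0" using finJ fin J by (auto simp: card_gt_0_iff)
  have split: "sum f U = sum f J + sum f (U - J)" for f :: "'i \<Rightarrow> complex"
    using J(1) fin by (metis add.commute sum.subset_diff)
  obtain l where l: "l \<in> spectrum (index_mat J L)" "spectral_radius (index_mat J L) = norm l"
    using spectral_radius_mem_max(1)[OF index_mat_carrier[of J L] nJ(1)] by blast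
  obtain y where y: "\<exists>i\<in>J. y i \<noteq> 0" "\<And>i. i \<in> J \<Longrightarrow> (\<Sum>c\<in>J. L c i * y c) = l * y i"
    using l(1) unfolding spectrum_def using eigenvalue_index_mat_left[OF finJ, of L l] by auto
  text \<open>A left eigenvector of the upper left block stays one after extension by zero.\<close>
  define x where "x i = (if i \<in> J then y i else 0)" for i
  have "(\<Sum>c\<in>U. L c j * x c) = l * x j" if "j \<in> U" for j
  proof -
    have "(\<Sum>c\<in>U. L c j * x c) = (\<Sum>c\<in>J. L c j * y c)"
      by (simp add: split x_def)
    also have "\<dots> = l * x j"
      using y(2) zero that by (cases "j \<in> J") (auto simp: x_def)
    finally show ?thesis .
  qed
  moreover have "\<exists>i\<in>U. x i \<noteq> 0" using y(1) J by (auto simp: x_def)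
  ultimately have "l \<in> spectrum (index_mat U L)"
    unfolding spectrum_def by (auto simp: eigenvalue_index_mat_left[OF fin])
  then show "spectral_radius (index_mat J L) \<le> spectral_radius (index_mat U L)"
    using spectral_radius_mem_max(2)[OF index_mat_carrier[of U L] nJ(2)] l(2) by auto
qed

section \<open>Charts of the tropical variety\<close>

lemma tree_nbr_in_tree: "t \<in> tree U \<Longrightarrow> k \<in> U \<Longrightarrow> tree_nbr k t \<in> tree U"
  by (cases t) (auto simp: tree_def dest: distinct_adj_ConsD)

text \<open>In a word without equal neighbouring letters, the letter after a cancelled
  \<open>k\<close> is not \<open>k\<close>, so the second step puts \<open>k\<close> back.\<close>

lemma tree_nbr_involutive: "t \<in> tree U \<Longrightarrow> tree_nbr k (tree_nbr k t) = t"
proof (cases t)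
  case (Cons l t')
  assume "t \<in> tree U"
  with Cons show ?thesis by (cases t') (auto simp: tree_def)
qed simp

text \<open>Row and column \<open>k\<close> change sign, which exchanges the two products of
  positive parts, so the second correction cancels the first.\<close>

lemma mat_mutation_involutive: "mat_mutation k (mat_mutation k b) = b"
  by (intro ext) (auto simp: mat_mutation_def max_def)

text \<open>If \<open>t\<close> begins with \<open>k\<close>, a letter is cancelled and the claim is
  the involutivity of mutation.\<close>

lemma mutate_word_tree_nbr: "mutate_word b (tree_nbr k t) = mat_mutation k (mutate_word b t)"
  by (cases t) (auto simp: mat_mutation_involutive)

text \<open>The condition under which the coordinates in \<open>J\<close> after a move are computed
  from those in \<open>J\<close> before it.\<close>

fun stabilizes :: "'i set \<Rightarrow> 'i move \<Rightarrow> bool" where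
  "stabilizes J (Hor k) \<longleftrightarrow> k \<in> J"
| "stabilizes J (Ver i j) \<longleftrightarrow> Transposition.transpose i j ` J = J"

lemma transpose_image_iff:
  assumes "Transposition.transpose i j ` J = J"
  shows "Transposition.transpose i j l \<in> J \<longleftrightarrow> l \<in> J"
  using assms by (metis image_eqI transpose_involutory)

text \<open>The effect of a move on matrices, detached from vertices so that patterns on different
  trees can be compared.\<close>

fun bmat_move :: "'i move \<Rightarrow> ('i \<Rightarrow> 'i \<Rightarrow> int) \<Rightarrow> 'i \<Rightarrow> 'i \<Rightarrow> int" where
  "bmat_move (Hor k) b = mat_mutation k b"
| "bmat_move (Ver i j) b = (\<lambda>l m. b (Transposition.transpose i j l) (Transposition.transpose i j m))"

lemma bmat_move_cong:
  assumes "\<And>i j. i \<in> I \<Longrightarrow> j \<in> I \<Longrightarrow> b i j = b' i j" "stabilizes I a" "i \<in> I" "j \<in> I"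
  shows "bmat_move a b i j = bmat_move a b' i j"
  using assms by (cases a) (auto simp: mat_mutation_def transpose_image_iff)

lemma trop_map_cong:
  assumes "\<And>i k. i \<in> J \<Longrightarrow> k \<in> J \<Longrightarrow> b i k = b' i k" "\<And>i. i \<in> J \<Longrightarrow> x i = x' i"
    and "stabilizes J a" "i \<in> J"
  shows "trop_map b a x i = trop_map b' a x' i"
  using assms by (cases a) (auto simp: transpose_image_iff)

text \<open>The sign of the \<open>k\<close>-th coordinate and the matrix entry both flip, so the
  coefficient is the same in both steps, while the coordinate it multiplies changes sign.\<close>

lemma trop_map_Hor_involutive:
  assumes "i \<noteq> k \<Longrightarrow> b' i k = - b i k"
  shows "trop_map b' (Hor k) (trop_map b (Hor k) x) i = x i"
  using assms by (auto simp: sgn_minus)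

section \<open>Labelled vertices, their exchange matrices and connectedness\<close>

locale seed =
  fixes s :: "'i seed_data"
  assumes pattern: "seed_pattern s"
begin

lemma finite_unfrozen: "finite (unfrozen s)"
  and finite_frozen: "finite (frozen s)"
  and unfrozen_frozen_disjoint: "unfrozen s \<inter> frozen s = {}"
  and exmat_skew: "t \<in> tree (unfrozen s) \<Longrightarrow> i \<in> indices s \<Longrightarrow> j \<in> indices s \<Longrightarrow>
    exmat s t j i = - exmat s t i j"
  and exmat_tree_nbr: "t \<in> tree (unfrozen s) \<Longrightarrow> k \<in> unfrozen s \<Longrightarrow> i \<in> indices s \<Longrightarrow>
    j \<in> indices s \<Longrightarrow> exmat s (tree_nbr k t) i j = mat_mutation k (exmat s t) i j"
  using pattern unfolding seed_pattern_def by blast+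

lemma unfrozen_subset_indices: "unfrozen s \<subseteq> indices s"
  by (auto simp: indices_def)

lemma labelings_inv:
  assumes "\<sigma> \<in> labelings s"
  shows "bij \<sigma>" "inv_into UNIV \<sigma> (\<sigma> i) = i" "\<sigma> (inv_into UNIV \<sigma> i) = i"
    "inv_into UNIV \<sigma> i \<in> unfrozen s \<longleftrightarrow> i \<in> unfrozen s"
    "inv_into UNIV \<sigma> i \<in> indices s \<longleftrightarrow> i \<in> indices s"
proof -
  have p: "\<sigma> permutes indices s" "\<sigma> ` unfrozen s = unfrozen s"
    using assms by (auto simp: labelings_def)
  show *: "bij \<sigma>" "inv_into UNIV \<sigma> (\<sigma> i) = i" "\<sigma> (inv_into UNIV \<sigma> i) = i"
    using permutes_bij[OF p(1)] permutes_inverses[OF p(1)] by auto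
  show "inv_into UNIV \<sigma> i \<in> unfrozen s \<longleftrightarrow> i \<in> unfrozen s"
    using p(2) * by (metis (no_types, lifting) imageE image_eqI permutes_inverses(2) p(1))
  show "inv_into UNIV \<sigma> i \<in> indices s \<longleftrightarrow> i \<in> indices s"
    using permutes_in_image[OF permutes_inv[OF p(1)]] .
qed

lemma transpose_comp_labeling:
  assumes "\<sigma> \<in> labelings s" "Transposition.transpose i j \<in> labelings s"
  shows "Transposition.transpose i j \<circ> \<sigma> \<in> labelings s"
  using assms image_comp[of "Transposition.transpose i j" \<sigma> "unfrozen s"]
  by (auto simp: labelings_def intro: permutes_compose)

lemma stabilizes_moves:
  assumes "a \<in> moves s"
  shows "stabilizes (unfrozen s) a" "stabilizes (indices s) a"
  using assms unfrozen_subset_indices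
  by (auto simp: moves_def labelings_def permutes_image)

lemma step_verts: "v \<in> verts s \<Longrightarrow> a \<in> moves s \<Longrightarrow> step v a \<in> verts s"
  by (cases v; cases a)
    (auto simp: verts_def moves_def labelings_inv intro: tree_nbr_in_tree transpose_comp_labeling)

lemma step_involutive: "v \<in> verts s \<Longrightarrow> step (step v a) a = v"
  by (cases v; cases a) (auto simp: verts_def tree_nbr_involutive o_assoc)

lemma bmat_step:
  assumes "v \<in> verts s" "a \<in> moves s" "i \<in> indices s" "j \<in> indices s"
  shows "bmat s (step v a) i j = bmat_move a (bmat s v) i j"
proof -
  obtain t \<sigma> where v: "v = (t, \<sigma>)" "t \<in> tree (unfrozen s)" "\<sigma> \<in> labelings s"
    using assms(1) by (auto simp: verts_def)
  note inv = labelings_inv[OF v(3)]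
  show ?thesis
  proof (cases a)
    case (Hor k)
    then have k: "k \<in> unfrozen s" using assms(2) by (auto simp: moves_def)
    \<comment> \<open>Mutation tests whether an index equals \<open>k\<close>, and this test
      survives relabelling.\<close>
    have inj: "inv_into UNIV \<sigma> l = inv_into UNIV \<sigma> m \<longleftrightarrow> l = m" for l m
      using inv(3) by metis
    show ?thesis
      using exmat_tree_nbr[OF v(2), of "inv_into UNIV \<sigma> k" "inv_into UNIV \<sigma> i" "inv_into UNIV \<sigma> j"]
        inv(4,5) k assms(3,4)
      by (simp add: Hor v(1) bmat_def mat_mutation_def inj)
  next
    case (Ver k l)
    then show ?thesis
      using inv(1) by (simp add: v(1) bmat_def o_inv_distrib)
  qed
qed

text \<open>Connectedness of the labelled exchange graph: horizontal edges build up the word under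
  the identity labelling, then vertical edges build up the labelling.\<close>

lemma verts_induct [consumes 1, case_names base step]:
  assumes "v \<in> verts s" "P base_vtx"
    and step: "\<And>v a. v \<in> verts s \<Longrightarrow> a \<in> moves s \<Longrightarrow> P v \<Longrightarrow> P (step v a)"
  shows "P v"
proof -
  obtain t \<sigma> where v: "v = (t, \<sigma>)" "t \<in> tree (unfrozen s)" "\<sigma> \<in> labelings s"
    using assms(1) by (auto simp: verts_def)
  have id: "id \<in> labelings s" by (simp add: labelings_def permutes_id)
  have tid: "P (t, id)" using v(2)
  proof (induction t)
    case Nil
    show ?case using assms(2) unfolding base_vtx_def .
  next
    case (Cons k t)
    have t: "t \<in> tree (unfrozen s)" "k \<in> unfrozen s"
      using Cons.prems by (auto simp: tree_def dest: distinct_adj_ConsD)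
    have "step (t, id) (Hor k) = (k # t, id)"
      using Cons.prems by (cases t) (auto simp: tree_def)
    moreover have "P (step (t, id) (Hor k))"
      using t id by (intro step Cons.IH) (auto simp: verts_def moves_def)
    ultimately show ?case by metis
  qed
  \<comment> \<open>Permutations of \<open>A\<close> are products of transpositions, multiplied on
    the left just as vertical edges do; a transposition inside one of the two index sets preserves
    both.\<close>
  have swap: "\<rho> \<in> labelings s \<Longrightarrow> P (t, \<rho>) \<Longrightarrow> \<tau> \<circ> \<rho> \<in> labelings s \<and> P (t, \<tau> \<circ> \<rho>)"
    if "\<tau> permutes A" "finite A" "A = unfrozen s \<or> A = frozen s" for A \<tau> \<rho>
    using that(1,2)
  proof (induction rule: permutes_induct)
    case id
    then show ?case by simp
  next
    case (swap a b \<tau>)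
    have tr: "Transposition.transpose a b \<in> labelings s"
    proof -
      have "Transposition.transpose a b permutes indices s"
        using swap that(3) by (intro permutes_swap_id) (auto simp: indices_def)
      moreover have "Transposition.transpose a b ` unfrozen s = unfrozen s"
      proof (cases "a \<in> unfrozen s")
        case True
        then have "b \<in> unfrozen s" using that(3) unfrozen_frozen_disjoint swap.hyps(1,2) by blast
        with True show ?thesis by (intro permutes_image permutes_swap_id)
      next
        case False
        then have "b \<notin> unfrozen s" using that(3) unfrozen_frozen_disjoint swap.hyps(1,2) by blast
        with False have "Transposition.transpose a b i = i" if "i \<in> unfrozen s" for i
          using that by (metis transpose_apply_other)
        then show ?thesis by simp
      qed
      ultimately show ?thesis by (simp add: labelings_def)
    qed
    have "\<tau> \<circ> \<rho> \<in> labelings s" "P (t, \<tau> \<circ> \<rho>)" using swap.IH swap.prems by blast+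
    then have "P (step (t, \<tau> \<circ> \<rho>) (Ver a b))"
      using v(2) tr swap.hyps(3) by (intro step) (auto simp: verts_def moves_def)
    then show ?case
      using transpose_comp_labeling[OF \<open>\<tau> \<circ> \<rho> \<in> labelings s\<close> tr] by (simp only: step.simps o_assoc)
  qed
  define \<sigma>U where "\<sigma>U i = (if i \<in> unfrozen s then \<sigma> i else i)" for i
  define \<sigma>F where "\<sigma>F i = (if i \<in> frozen s then \<sigma> i else i)" for i
  have \<sigma>: "\<sigma> permutes indices s" "\<sigma> ` unfrozen s = unfrozen s"
    using v(3) by (auto simp: labelings_def)
  have inj: "inj \<sigma>" using \<sigma>(1) permutes_inj by blast
  have frozen_eq: "frozen s = indices s - unfrozen s"
    using unfrozen_frozen_disjoint by (auto simp: indices_def)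
  have \<sigma>F_img: "\<sigma> ` frozen s = frozen s"
    unfolding frozen_eq image_set_diff[OF inj] \<sigma>(2) permutes_image[OF \<sigma>(1)] ..
  have "\<sigma>U permutes unfrozen s"
    using \<sigma>(2) inj by (intro bij_imp_permutes)
      (auto simp: \<sigma>U_def bij_betw_def inj_on_def image_def)
  moreover have "\<sigma>F permutes frozen s"
    using \<sigma>F_img inj by (intro bij_imp_permutes)
      (auto simp: \<sigma>F_def bij_betw_def inj_on_def image_def)
  moreover have "\<sigma> = \<sigma>U \<circ> (\<sigma>F \<circ> id)"
  proof
    fix i
    consider "i \<in> unfrozen s" | "i \<in> frozen s" | "i \<notin> indices s" by (auto simp: indices_def)
    then show "\<sigma> i = (\<sigma>U \<circ> (\<sigma>F \<circ> id)) i"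
      using \<sigma>F_img unfrozen_frozen_disjoint permutes_not_in[OF \<sigma>(1)]
      by cases (auto simp: \<sigma>U_def \<sigma>F_def indices_def)
  qed
  ultimately show ?thesis
    unfolding v(1) using swap[OF _ finite_frozen disjI2[OF refl] id tid]
      swap[OF _ finite_unfrozen disjI1[OF refl]] by metis
qed

lemma base_vtx_verts: "base_vtx \<in> verts s"
  by (simp add: base_vtx_def verts_def tree_def labelings_def permutes_id)

lemma bmat_skew_step:
  assumes "v \<in> verts s" "k \<in> unfrozen s" "i \<in> indices s"
  shows "bmat s (step v (Hor k)) i k = - bmat s v i k"
  using assms unfrozen_subset_indices
  by (subst bmat_step) (auto simp: moves_def mat_mutation_def)

lemma trop_map_step_involutive:
  assumes "v \<in> verts s" "a \<in> moves s" "i \<in> unfrozen s"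
  shows "trop_map (bmat s (step v a)) a (trop_map (bmat s v) a x) i = x i"
proof (cases a)
  case (Hor k)
  then show ?thesis
    using assms unfrozen_subset_indices bmat_skew_step[of v k i]
    by (simp only: Hor) (rule trop_map_Hor_involutive, auto simp: moves_def)
qed simp

section \<open>Uniqueness and existence of points with given coordinates in one chart\<close>

lemma trop_variety_step:
  assumes "w \<in> trop_variety s" "v \<in> verts s" "a \<in> moves s" "i \<in> unfrozen s"
  shows "w (step v a) i = trop_map (bmat s v) a (w v) i"
  using assms by (simp add: trop_variety_def)

lemma trop_variety_outside:
  assumes "w \<in> trop_variety s" "v \<notin> verts s \<or> i \<notin> unfrozen s"
  shows "w v i = 0"
  using assms unfolding trop_variety_def by blast

lemma trop_variety_agree_step:
  assumes "w \<in> trop_variety s" "w' \<in> trop_variety s" "v \<in> verts s" "a \<in> moves s"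
    and "\<forall>i\<in>unfrozen s. w v i = w' v i"
  shows "\<forall>i\<in>unfrozen s. w (step v a) i = w' (step v a) i"
  using assms stabilizes_moves
  by (auto simp: trop_variety_step intro!: trop_map_cong[of "unfrozen s"])

text \<open>Edges can be traversed both ways, so agreement travels from \<open>v\<close> to
  \<open>base_vtx\<close> and from there to every chart.\<close>

lemma trop_variety_eqI:
  assumes w: "w \<in> trop_variety s" "w' \<in> trop_variety s"
    and v: "v \<in> verts s" "\<And>i. i \<in> unfrozen s \<Longrightarrow> w v i = w' v i"
  shows "w = w'"
proof -
  \<comment> \<open>Induction starts at \<open>base_vtx\<close>, so the way back to it is phrased as
    an implication.\<close>
  have "(\<forall>i\<in>unfrozen s. w v i = w' v i) \<longrightarrow> (\<forall>i\<in>unfrozen s. w base_vtx i = w' base_vtx i)"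
    using v(1)
  proof (induction rule: verts_induct)
    case (step v a)
    then show ?case
      using trop_variety_agree_step[OF w step_verts[OF step(1,2)] step(2)] step_involutive by metis
  qed simp
  then have base: "\<forall>i\<in>unfrozen s. w base_vtx i = w' base_vtx i" using v(2) by blast
  have "\<forall>i\<in>unfrozen s. w u i = w' u i" if "u \<in> verts s" for u
    using that
  proof (induction rule: verts_induct)
    case (step v a)
    then show ?case using trop_variety_agree_step[OF w step(1,2)] by blast
  qed (rule base)
  then show ?thesis using trop_variety_outside w by (intro ext) metis
qed

text \<open>Transports the coordinates \<open>x\<close> at \<open>base_vtx\<close> along the tree,
  with the identity labelling throughout.\<close>

fun trop_word :: "('i \<Rightarrow> real) \<Rightarrow> 'i list \<Rightarrow> 'i \<Rightarrow> real" where
  "trop_word x [] = x"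
| "trop_word x (k # t) = trop_map (exmat s t) (Hor k) (trop_word x t)"

declare trop_map.simps(1) [simp del]

text \<open>A step away from the root is the recursion itself; a step towards it undoes the last
  map, since column \<open>k\<close> of the matrix has changed sign.\<close>

lemma trop_word_tree_nbr:
  assumes "t \<in> tree (unfrozen s)" "k \<in> unfrozen s" "i \<in> indices s"
  shows "trop_word x (tree_nbr k t) i = trop_map (exmat s t) (Hor k) (trop_word x t) i"
proof (cases "\<exists>t'. t = k # t'")
  case True
  then obtain t' where t: "t = k # t'" by blast
  have t': "t' \<in> tree (unfrozen s)" "tree_nbr k t' = t"
    using assms(1) t by (cases t'; auto simp: tree_def)+
  have "exmat s t i k = - exmat s t' i k"
    using exmat_tree_nbr[OF t'(1) assms(2,3), of k] t'(2) assms(2) unfrozen_subset_indices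
    by (auto simp: mat_mutation_def)
  then show ?thesis
    using trop_map_Hor_involutive[of i k "exmat s t" "exmat s t'" "trop_word x t'"] by (simp add: t)
next
  case False
  then have "tree_nbr k t = k # t" by (cases t) auto
  then show ?thesis by simp
qed

lemma trop_variety_ex_base:
  "\<exists>w\<in>trop_variety s. \<forall>i\<in>unfrozen s. w base_vtx i = x i"
proof -
  \<comment> \<open>The transported coordinates are relabelled by the inverse labelling; zero
    elsewhere is the convention of \<open>trop_variety\<close>.\<close>
  define w where "w v i = (if v \<in> verts s \<and> i \<in> unfrozen s
    then trop_word x (fst v) (inv_into UNIV (snd v) i) else 0)" for v i
  have "w (step v a) i = trop_map (bmat s v) a (w v) i"
    if v: "v \<in> verts s" and a: "a \<in> moves s" and i: "i \<in> unfrozen s" for v a i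
  proof -
    obtain t \<sigma> where v': "v = (t, \<sigma>)" "t \<in> tree (unfrozen s)" "\<sigma> \<in> labelings s"
      using v by (auto simp: verts_def)
    note inv = labelings_inv[OF v'(3)]
    show ?thesis
    proof (cases a)
      case (Hor k)
      then have k: "k \<in> unfrozen s" using a by (auto simp: moves_def)
      have inj: "inv_into UNIV \<sigma> l = inv_into UNIV \<sigma> m \<longleftrightarrow> l = m" for l m
        using inv(3) by metis
      have "w (step v a) i = trop_word x (tree_nbr (inv_into UNIV \<sigma> k) t) (inv_into UNIV \<sigma> i)"
        using step_verts[OF v a] i by (simp add: w_def v'(1) Hor)
      also have "\<dots> = trop_map (exmat s t) (Hor (inv_into UNIV \<sigma> k)) (trop_word x t) (inv_into UNIV \<sigma> i)"
        using i k inv(4,5) unfrozen_subset_indices by (intro trop_word_tree_nbr v'(2)) auto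
      also have "\<dots> = trop_map (bmat s v) (Hor k) (w v) i"
        using v i k by (simp add: trop_map.simps inj w_def v'(1) bmat_def)
      finally show ?thesis by (simp add: Hor)
    next
      case (Ver k l)
      then have "Transposition.transpose k l i \<in> unfrozen s"
        using stabilizes_moves[OF a] i by (auto simp: transpose_image_iff)
      then show ?thesis
        using step_verts[OF v a] v i inv(1) by (simp add: w_def v'(1) Ver o_inv_distrib)
    qed
  qed
  then have "w \<in> trop_variety s" by (auto simp: trop_variety_def w_def)
  moreover have "\<forall>i\<in>unfrozen s. w base_vtx i = x i"
    using base_vtx_verts by (simp add: w_def) (simp add: base_vtx_def)
  ultimately show ?thesis by blast
qed

text \<open>Prescribed coordinates are pulled back edge by edge to \<open>base_vtx\<close>, which is
  why \<open>x\<close> varies in the induction.\<close>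

lemma trop_variety_ex:
  assumes "v \<in> verts s"
  shows "\<exists>w\<in>trop_variety s. \<forall>i\<in>unfrozen s. w v i = x i"
  using assms
proof (induction arbitrary: x rule: verts_induct)
  case base
  show ?case by (rule trop_variety_ex_base)
next
  case (step v a)
  obtain w where w: "w \<in> trop_variety s"
    "\<forall>i\<in>unfrozen s. w v i = trop_map (bmat s (step v a)) a x i"
    using step.IH by blast
  have "w (step v a) i = x i" if i: "i \<in> unfrozen s" for i
  proof -
    have "w (step v a) i = trop_map (bmat s v) a (trop_map (bmat s (step v a)) a x) i"
      using w step(1,2) i stabilizes_moves
      by (auto simp: trop_variety_step intro!: trop_map_cong[of "unfrozen s"])
    also have "\<dots> = x i"
      using trop_map_step_involutive[OF step_verts[OF step(1,2)] step(2) i] step_involutive[OF step(1)]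
      by simp
    finally show ?thesis .
  qed
  then show ?case using w(1) by blast
qed

section \<open>The zero point and the action of a path\<close>

lemma trop_zero_variety: "trop_zero \<in> trop_variety s"
proof -
  have "trop_map b a (\<lambda>_. 0) i = 0" for b and a :: "'i move" and i
    by (cases a) (auto simp: trop_map.simps)
  then show ?thesis by (simp add: trop_variety_def trop_zero_def)
qed

text \<open>Justifies the definite description: one chart determines a point, and any coordinates
  there are realised.\<close>

lemma trop_act:
  assumes "epath s \<gamma>" "w \<in> trop_variety s"
  shows "trop_act s \<gamma> w \<in> trop_variety s" "trop_act s \<gamma> w (fst \<gamma>) = w (target \<gamma>)"
proof -
  have v: "fst \<gamma> \<in> verts s" using assms by (simp add: epath_def)
  obtain w' where w': "w' \<in> trop_variety s" "\<forall>i\<in>unfrozen s. w' (fst \<gamma>) i = w (target \<gamma>) i"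
    using trop_variety_ex[OF v] by blast
  have "\<exists>!w'. w' \<in> trop_variety s \<and> w' (fst \<gamma>) = w (target \<gamma>)"
  proof (rule ex1I[of _ w'])
    show "w' \<in> trop_variety s \<and> w' (fst \<gamma>) = w (target \<gamma>)"
      \<comment> \<open>Both coordinate functions vanish at indices that are not unfrozen, so they
        agree as functions.\<close>
      using w' trop_variety_outside[OF w'(1)] trop_variety_outside[OF assms(2)]
      by (intro conjI ext) metis+
    show "w'' = w'" if "w'' \<in> trop_variety s \<and> w'' (fst \<gamma>) = w (target \<gamma>)" for w''
      using that w' by (intro trop_variety_eqI[OF _ _ v]) auto
  qed
  from theI'[OF this] show "trop_act s \<gamma> w \<in> trop_variety s" "trop_act s \<gamma> w (fst \<gamma>) = w (target \<gamma>)"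
    unfolding trop_act_def by blast+
qed

lemma trop_act_funpow:
  "epath s \<gamma> \<Longrightarrow> w \<in> trop_variety s \<Longrightarrow> (trop_act s \<gamma> ^^ n) w \<in> trop_variety s"
  by (induction n) (auto simp: trop_act)

end

text \<open>The mutation rule is \<open>mutate_word_tree_nbr\<close>; skew-symmetry starts at
  \<open>v0\<close> and is inherited along words.\<close>

lemma seed_reduced_pattern:
  assumes "seed s" "v0 \<in> verts s" "K \<subseteq> unfrozen s"
  shows "seed (reduced_pattern s v0 K)"
proof
  interpret seed s by fact
  let ?r = "reduced_pattern s v0 K"
  have ind: "indices ?r = indices s"
    using assms(3) by (auto simp: indices_def reduced_pattern_def)
  obtain t0 \<sigma>0 where v0: "v0 = (t0, \<sigma>0)" "t0 \<in> tree (unfrozen s)" "\<sigma>0 \<in> labelings s"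
    using assms(2) by (auto simp: verts_def)
  have skew: "mutate_word (bmat s v0) t j i = - mutate_word (bmat s v0) t i j"
    if "set t \<subseteq> indices s" "i \<in> indices s" "j \<in> indices s" for t i j
    using that
  proof (induction t arbitrary: i j)
    case Nil
    then show ?case
      using v0 labelings_inv(5)[OF v0(3)] by (auto simp: bmat_def intro!: exmat_skew)
  next
    case (Cons k t)
    \<comment> \<open>A mutated entry involves only entries with indices among \<open>i\<close>,
      \<open>j\<close> and \<open>k\<close>.\<close>
    have "mutate_word (bmat s v0) t l m = - mutate_word (bmat s v0) t m l"
      if "l \<in> {i, j, k}" "m \<in> {i, j, k}" for l m
      using Cons that by auto
    from this[of i j] this[of i k] this[of j k] show ?case
      by (simp add: mat_mutation_def mult.commute)
  qed
  have tree: "set t \<subseteq> indices s" if "t \<in> tree (unfrozen ?r)" for t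
    using that unfrozen_subset_indices by (auto simp: tree_def reduced_pattern_def)
  have r: "exmat ?r = mutate_word (bmat s v0)" by (simp add: reduced_pattern_def)
  have "finite (unfrozen ?r)" "finite (frozen ?r)" "unfrozen ?r \<inter> frozen ?r = {}"
    using finite_unfrozen finite_frozen unfrozen_frozen_disjoint assms(3)
    by (auto simp: reduced_pattern_def intro: finite_subset)
  then show "seed_pattern ?r"
    unfolding seed_pattern_def ind r mutate_word_tree_nbr using skew[OF tree] by blast
qed

section \<open>Presentation matrices\<close>

text \<open>For fixed signs every move is linear and closed on the coordinates in \<open>U\<close>,
  so the values on unit vectors are the matrix entries.\<close>

lemma presentation_linear:
  assumes "finite U" "\<forall>a\<in>set p. stabilizes U a" "i \<in> U"
  shows "presentation s v p \<epsilon> x i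
    = (\<Sum>c\<in>U. presentation s v p \<epsilon> (\<lambda>j. if j = c then 1 else 0) i * x c)"
  using assms(2,3)
proof (induction p arbitrary: v \<epsilon> x i)
  case Nil
  have "(\<Sum>c\<in>U. (if i = c then 1 else 0) * x c) = (\<Sum>c\<in>U. if i = c then x c else 0)"
    by (intro sum.cong) auto
  then show ?case using Nil assms(1) by (simp add: sum.delta')
next
  case (Cons a p)
  \<comment> \<open>One move turns unit vectors into other vectors, so the induction hypothesis is
    first extended to linear combinations of an arbitrary family \<open>e\<close>.\<close>
  have *: "presentation s v p \<epsilon>' y i = (\<Sum>c\<in>U. presentation s v p \<epsilon>' (e c) i * x c)"
    if y: "\<And>j. j \<in> U \<Longrightarrow> y j = (\<Sum>c\<in>U. e c j * x c)" for v \<epsilon>' y e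
  proof -
    let ?P = "\<lambda>d. presentation s v p \<epsilon>' (\<lambda>j. if j = d then 1 else 0) i"
    have IH: "presentation s v p \<epsilon>' z i = (\<Sum>d\<in>U. ?P d * z d)" for z
      by (rule Cons.IH) (use Cons.prems in auto)
    have "presentation s v p \<epsilon>' y i = (\<Sum>d\<in>U. \<Sum>c\<in>U. ?P d * (e c d * x c))"
      unfolding IH[of y] by (intro sum.cong refl) (simp add: y sum_distrib_left)
    also have "\<dots> = (\<Sum>c\<in>U. \<Sum>d\<in>U. ?P d * (e c d * x c))"
      by (rule sum.swap)
    also have "\<dots> = (\<Sum>c\<in>U. presentation s v p \<epsilon>' (e c) i * x c)"
      unfolding IH[of "e _"] by (simp add: sum_distrib_right mult.assoc)
    finally show ?thesis .
  qed
  have delta: "(\<Sum>c\<in>U. (if j = c then b else 0) * x c) = b * x j" if "j \<in> U" for j b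
  proof -
    have "(\<Sum>c\<in>U. (if j = c then b else 0) * x c) = (\<Sum>c\<in>U. if j = c then b * x c else 0)"
      by (intro sum.cong) auto
    then show ?thesis using that assms(1) by (simp add: sum.delta')
  qed
  show ?case
  proof (cases a)
    case (Hor k)
    then have k: "k \<in> U" using Cons.prems by simp
    show ?thesis
    proof (simp only: Hor presentation.simps, rule *)
      fix j assume j: "j \<in> U"
      show "sgn_mutation (bmat s v) k (hd \<epsilon>) x j
        = (\<Sum>c\<in>U. sgn_mutation (bmat s v) k (hd \<epsilon>) (\<lambda>j. if j = c then 1 else 0) j * x c)"
      proof (cases "j = k")
        case True
        then show ?thesis using delta[OF k, of 1] by (simp add: sum_negf)
      next
        case False
        then show ?thesis
          using delta[OF j, of 1] delta[OF k, of "max (hd \<epsilon> * of_int (bmat s v j k)) 0"]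
          by (simp add: distrib_right sum.distrib if_distrib[of "\<lambda>z. _ * z"] cong: if_cong)
      qed
    qed
  next
    case (Ver k l)
    then have tr: "Transposition.transpose k l j \<in> U \<longleftrightarrow> j \<in> U" for j
      using Cons.prems by (simp add: transpose_image_iff)
    show ?thesis
    proof (simp only: Ver presentation.simps, rule *)
      fix j assume "j \<in> U"
      then show "x (Transposition.transpose k l j)
        = (\<Sum>c\<in>U. (if Transposition.transpose k l j = c then 1 else 0) * x c)"
        using delta[of "Transposition.transpose k l j" 1] tr by simp
    qed
  qed
qed

text \<open>The coefficients are positive parts of integers, because the signs are 1 or -1.\<close>

lemma presentation_Ints:
  assumes "set \<epsilon> \<subseteq> {1, -1}" "length \<epsilon> = length (filter (\<lambda>a. \<exists>k. a = Hor k) p)"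
    and "\<And>j. x j \<in> \<int>"
  shows "presentation s v p \<epsilon> x i \<in> \<int>"
  using assms
proof (induction p arbitrary: v \<epsilon> x)
  case (Cons a p)
  show ?case
  proof (cases a)
    case (Hor k)
    \<comment> \<open>The length condition leaves a sign for this horizontal move, so
      \<open>hd \<epsilon>\<close> is not a default value.\<close>
    then obtain e \<epsilon>' where e: "\<epsilon> = e # \<epsilon>'" "e \<in> \<int>"
      using Cons.prems(1,2) by (cases \<epsilon>) auto
    have "max z 0 \<in> \<int>" if "z \<in> \<int>" for z :: real
      using that by (simp add: max_def)
    then show ?thesis
      using Cons.prems e by (simp add: Hor) (intro Cons.IH; auto)
  next
    case (Ver k l)
    then show ?thesis using Cons.prems by (simp add: Cons.IH)
  qed
qed simp

text \<open>Each move is injective on \<open>J\<close> for any sign: the \<open>k\<close>-th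
  coordinate must vanish first, and with it all correction terms.\<close>

lemma presentation_eq_0D:
  assumes "\<forall>a\<in>set p. stabilizes J a" "\<forall>j\<in>J. presentation s v p \<epsilon> x j = 0" "i \<in> J"
  shows "x i = 0"
  using assms
proof (induction p arbitrary: v \<epsilon> x i)
  case (Cons a p)
  show ?case
  proof (cases a)
    case (Hor k)
    then have k: "k \<in> J" using Cons.prems by simp
    let ?y = "sgn_mutation (bmat s v) k (hd \<epsilon>) x"
    have y: "?y j = 0" if "j \<in> J" for j
      using Cons.IH[of "step v (Hor k)" "tl \<epsilon>" ?y j] Cons.prems that by (simp add: Hor)
    from y[OF k] have "x k = 0" by simp
    with y[OF Cons.prems(3)] show ?thesis by (cases "i = k") auto
  next
    case (Ver k l)
    let ?y = "\<lambda>j. x (Transposition.transpose k l j)"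
    have tr: "Transposition.transpose k l j \<in> J \<longleftrightarrow> j \<in> J" for j
      using Cons.prems Ver by (simp add: transpose_image_iff)
    have "?y j = 0" if "j \<in> J" for j
      using Cons.IH[of "step v (Ver k l)" \<epsilon> ?y j] Cons.prems that by (simp add: Ver)
    from this[of "Transposition.transpose k l i"] show ?thesis using tr Cons.prems(3) by simp
  qed
qed simp

text \<open>Horizontal moves only add multiples of a coordinate in \<open>J\<close>, so they fix
  vectors vanishing on \<open>J\<close>. Vertical moves remain, and they permute
  \<open>K\<close>.\<close>

lemma presentation_off_block:
  assumes "\<forall>a\<in>set p. stabilizes J a \<and> ((\<exists>k. a = Hor k) \<or> stabilizes K a)"
    and "J \<inter> K = {}"
  shows "\<exists>\<pi>. \<pi> permutes K \<and> (\<forall>x. (\<forall>j\<in>J. x j = 0) \<longrightarrow>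
    (\<forall>i\<in>K. presentation s v p \<epsilon> x i = x (\<pi> i)))"
  using assms(1)
proof (induction p arbitrary: v \<epsilon>)
  case Nil
  show ?case by (intro exI[of _ id] conjI permutes_id) simp
next
  case (Cons a p)
  show ?case
  proof (cases a)
    case (Hor k)
    then have k: "k \<in> J" using Cons.prems by auto
    obtain \<pi> where \<pi>: "\<pi> permutes K"
      "\<And>x i. \<forall>j\<in>J. x j = 0 \<Longrightarrow> i \<in> K \<Longrightarrow> presentation s (step v (Hor k)) p (tl \<epsilon>) x i = x (\<pi> i)"
      using Cons.IH[of "step v (Hor k)" "tl \<epsilon>"] Cons.prems by auto
    have "sgn_mutation (bmat s v) k (hd \<epsilon>) x = x" if "\<forall>j\<in>J. x j = 0" for x
      using that k by auto
    then show ?thesis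
      using \<pi> by (intro exI[of _ \<pi>]) (simp del: sgn_mutation.simps add: Hor)
  next
    case (Ver k l)
    then have st: "Transposition.transpose k l ` J = J" "Transposition.transpose k l ` K = K"
      using Cons.prems by auto
    obtain \<pi> where \<pi>: "\<pi> permutes K"
      "\<And>x i. \<forall>j\<in>J. x j = 0 \<Longrightarrow> i \<in> K \<Longrightarrow> presentation s (step v (Ver k l)) p \<epsilon> x i = x (\<pi> i)"
      using Cons.IH[of "step v (Ver k l)" \<epsilon>] Cons.prems by auto
    \<comment> \<open>The transposition may move indices outside \<open>K\<close>, so the composite
      is cut off there.\<close>
    define \<rho> where "\<rho> i = (if i \<in> K then Transposition.transpose k l (\<pi> i) else i)" for i
    have "bij_betw (Transposition.transpose k l) K K"
      unfolding bij_betw_def inj_on_def using st(2) transpose_involutory by metis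
    then have "bij_betw (Transposition.transpose k l \<circ> \<pi>) K K"
      by (rule bij_betw_trans[OF permutes_imp_bij[OF \<pi>(1)]])
    then have "bij_betw \<rho> K K"
      by (rule bij_betw_cong[THEN iffD1, rotated]) (simp add: \<rho>_def)
    then have "\<rho> permutes K" by (rule bij_imp_permutes) (simp add: \<rho>_def)
    moreover have "presentation s v (a # p) \<epsilon> x i = x (\<rho> i)"
      if "\<forall>j\<in>J. x j = 0" "i \<in> K" for x i
      using \<pi>(2)[of "\<lambda>j. x (Transposition.transpose k l j)" i] that transpose_image_iff[OF st(1)]
      by (simp add: Ver \<rho>_def)
    ultimately show ?thesis by blast
  qed
qed

section \<open>Cluster reduction\<close>

locale reduction = seed s for s :: "'i seed_data" +
  fixes v0 :: "'i vtx" and K :: "'i set" and sG :: "'i seed_data"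
  assumes v0: "v0 \<in> verts s" and K: "K \<subseteq> unfrozen s"
    and sG: "sG = reduced_pattern s v0 K"
begin

sublocale red: seed sG
  unfolding sG using seed_reduced_pattern[OF seed_axioms v0 K] .

lemma unfrozen_sG: "unfrozen sG = unfrozen s - K"
  by (simp add: sG reduced_pattern_def)

lemma indices_sG: "indices sG = indices s"
  using K by (auto simp: sG indices_def reduced_pattern_def)

lemma moves_in_moves: "moves_in s K \<subseteq> moves s"
  by (auto simp: moves_in_def moves_def)

lemma moves_in_stabilizes:
  assumes "a \<in> moves_in s K"
  shows "stabilizes (unfrozen s - K) a" "(\<exists>k. a = Hor k) \<or> stabilizes K a"
  using assms by (auto simp: moves_in_def labelings_def image_set_diff)

lemma moves_in_moves_sG: "moves_in s K \<subseteq> moves sG"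
  unfolding moves_in_def moves_def labelings_def unfrozen_sG indices_sG
  by (auto simp: image_set_diff)

text \<open>
  Holds between a vertex in the component of \<open>v0\<close> and the vertex of the reduced pattern reached from
  \<open>base_vtx\<close> by the same edge labels.
\<close>

definition corr :: "'i vtx \<Rightarrow> 'i vtx \<Rightarrow> bool" where
  "corr u u' \<longleftrightarrow> u \<in> verts s \<and> u' \<in> verts sG \<and>
    (\<forall>i\<in>indices s. \<forall>j\<in>indices s. bmat s u i j = bmat sG u' i j)"

lemma corr_base: "corr v0 base_vtx"
  using v0 red.base_vtx_verts
  by (simp add: corr_def) (simp add: bmat_def base_vtx_def sG reduced_pattern_def)

lemma corr_step:
  assumes "corr u u'" "a \<in> moves_in s K"
  shows "corr (step u a) (step u' a)"
proof -
  have a: "a \<in> moves s" "a \<in> moves sG"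
    using assms(2) moves_in_moves moves_in_moves_sG by auto
  have u: "u \<in> verts s" "u' \<in> verts sG" using assms(1) by (auto simp: corr_def)
  have "bmat s (step u a) i j = bmat sG (step u' a) i j" if "i \<in> indices s" "j \<in> indices s" for i j
    using bmat_step[OF u(1) a(1) that] red.bmat_step[OF u(2) a(2), of i j] that assms(1)
      bmat_move_cong[of "indices s" "bmat s u" "bmat sG u'" a i j] stabilizes_moves(2)[OF a(1)]
    by (auto simp: indices_sG corr_def)
  then show ?thesis
    using step_verts[OF u(1) a(1)] red.step_verts[OF u(2) a(2)] by (simp add: corr_def)
qed

text \<open>Horizontal labels avoid \<open>K\<close> and transpositions preserve it, so only matrix
  entries and coordinates with indices outside \<open>K\<close> enter.\<close>

lemma corr_step_trop:
  assumes c: "corr u u'" and a: "a \<in> moves_in s K"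
    and w: "w \<in> trop_variety s" "w' \<in> trop_variety sG"
    and eq: "\<And>j. j \<in> unfrozen s - K \<Longrightarrow> w u j = w' u' j"
    and j: "j \<in> unfrozen s - K"
  shows "w (step u a) j = w' (step u' a) j"
proof -
  have b: "bmat s u i k = bmat sG u' i k" if "i \<in> unfrozen s - K" "k \<in> unfrozen s - K" for i k
    using c that unfrozen_subset_indices unfolding corr_def by blast
  have "w (step u a) j = trop_map (bmat s u) a (w u) j"
    using c a moves_in_moves w j by (intro trop_variety_step) (auto simp: corr_def)
  also have "\<dots> = trop_map (bmat sG u') a (w' u') j"
    by (rule trop_map_cong[OF b eq moves_in_stabilizes(1)[OF a] j])
  also have "\<dots> = w' (step u' a) j"
    using c a moves_in_moves_sG w j
    by (intro red.trop_variety_step[symmetric]) (auto simp: corr_def unfrozen_sG)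
  finally show ?thesis .
qed

lemma corr_foldl_trop:
  assumes "corr u u'" "set q \<subseteq> moves_in s K"
    and "w \<in> trop_variety s" "w' \<in> trop_variety sG"
    and "\<And>j. j \<in> unfrozen s - K \<Longrightarrow> w u j = w' u' j"
    and "j \<in> unfrozen s - K"
  shows "w (foldl step u q) j = w' (foldl step u' q) j"
  using assms
proof (induction q arbitrary: u u' j)
  case (Cons a q)
  have a: "a \<in> moves_in s K" "set q \<subseteq> moves_in s K" using Cons.prems(2) by auto
  have eq: "w (step u a) i = w' (step u' a) i" if "i \<in> unfrozen s - K" for i
    by (rule corr_step_trop[OF Cons.prems(1) a(1) Cons.prems(3,4,5) that])
  show ?case
    using Cons.IH[OF corr_step[OF Cons.prems(1) a(1)] a(2) Cons.prems(3,4) eq Cons.prems(6)] by simp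
qed simp

text \<open>The recorded signs belong to labels of horizontal moves, which lie outside
  \<open>K\<close>.\<close>

lemma signs_along_eq:
  assumes "corr u u'" "set q \<subseteq> moves_in s K"
    and "w \<in> trop_variety s" "w' \<in> trop_variety sG"
    and "\<And>j. j \<in> unfrozen s - K \<Longrightarrow> w u j = w' u' j"
  shows "signs_along u q w = signs_along u' q w'"
  using assms
proof (induction q arbitrary: u u')
  case (Cons a q)
  have a: "a \<in> moves_in s K" "set q \<subseteq> moves_in s K" using Cons.prems(2) by auto
  have eq: "w (step u a) i = w' (step u' a) i" if "i \<in> unfrozen s - K" for i
    by (rule corr_step_trop[OF Cons.prems(1) a(1) Cons.prems(3,4,5) that])
  have "signs_along (step u a) q w = signs_along (step u' a) q w'"
    by (rule Cons.IH[OF corr_step[OF Cons.prems(1) a(1)] a(2) Cons.prems(3,4) eq])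
  moreover have "k \<in> unfrozen s - K" if "a = Hor k" for k
    using a(1) that by (auto simp: moves_in_def)
  ultimately show ?case using Cons.prems(5) by (cases a) auto
qed simp

lemma presentation_eq:
  assumes "corr u u'" "set q \<subseteq> moves_in s K"
    and "\<And>j. j \<in> unfrozen s - K \<Longrightarrow> x j = x' j" "i \<in> unfrozen s - K"
  shows "presentation s u q \<epsilon> x i = presentation sG u' q \<epsilon> x' i"
  using assms
proof (induction q arbitrary: u u' \<epsilon> x x')
  case (Cons a q)
  have a: "a \<in> moves_in s K" using Cons.prems by simp
  show ?case
  proof (cases a)
    case (Hor k)
    then have k: "k \<in> unfrozen s - K" using a by (auto simp: moves_in_def)
    have "sgn_mutation (bmat s u) k e x j = sgn_mutation (bmat sG u') k e x' j"
      if "j \<in> unfrozen s - K" for j e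
    proof -
      have "bmat s u j k = bmat sG u' j k"
        using Cons.prems(1) that k unfrozen_subset_indices unfolding corr_def by blast
      then show ?thesis using Cons.prems(3)[OF k] Cons.prems(3)[OF that] by simp
    qed
    then show ?thesis
      unfolding Hor presentation.simps
      using Cons.prems corr_step[OF Cons.prems(1) a] by (intro Cons.IH) (auto simp: Hor)
  next
    case (Ver k l)
    have "Transposition.transpose k l j \<in> unfrozen s - K" if "j \<in> unfrozen s - K" for j
      using moves_in_stabilizes(1)[OF a] that transpose_image_iff unfolding Ver by fastforce
    then show ?thesis
      unfolding Ver presentation.simps
      using Cons.prems corr_step[OF Cons.prems(1) a] by (intro Cons.IH) (auto simp: Ver)
  qed
qed simp

section \<open>The reduction map and its compatibility with the actions\<close>

lemma reduction_map:
  assumes w: "w \<in> trop_variety s"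
  shows "reduction_map s v0 K w \<in> trop_variety sG"
    and "j \<in> unfrozen s - K \<Longrightarrow> reduction_map s v0 K w base_vtx j = w v0 j"
proof -
  let ?Q = "\<lambda>w'. w' \<in> trop_variety sG \<and> (\<forall>q. set q \<subseteq> moves_in s K \<longrightarrow>
        (\<forall>j\<in>unfrozen s - K. w' (target (reduced_path q)) j = w (target (v0, q)) j))"
  \<comment> \<open>The candidate is fixed by its coordinates at \<open>base_vtx\<close>;
    \<open>corr_foldl_trop\<close> then gives the condition along every \<open>q\<close>.\<close>
  obtain w' where w': "w' \<in> trop_variety sG" "\<And>j. j \<in> unfrozen s - K \<Longrightarrow> w' base_vtx j = w v0 j"
    using red.trop_variety_ex_base[of "w v0"] by (auto simp: unfrozen_sG)
  have Q: "?Q w'"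
    using corr_foldl_trop[OF corr_base _ w w'(1)] w'
    by (auto simp: target_def reduced_path_def)
  \<comment> \<open>The empty path already determines the point.\<close>
  moreover have "w'' = w'" if "?Q w''" for w''
  proof (rule red.trop_variety_eqI[OF _ w'(1) red.base_vtx_verts])
    show "w'' \<in> trop_variety sG" using that by blast
    show "w'' base_vtx j = w' base_vtx j" if "j \<in> unfrozen sG" for j
      using \<open>?Q w''\<close>[THEN conjunct2, rule_format, of "[]" j] w'(2)[of j] that
      by (simp add: target_def reduced_path_def unfrozen_sG)
  qed
  ultimately have "reduction_map s v0 K w = w'"
    unfolding reduction_map_def sG[symmetric] by (intro the_equality) blast+
  then show "reduction_map s v0 K w \<in> trop_variety sG"
    and "j \<in> unfrozen s - K \<Longrightarrow> reduction_map s v0 K w base_vtx j = w v0 j"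
    using w' by auto
qed

lemma reduction_map_eqI:
  assumes "w \<in> trop_variety s" "w' \<in> trop_variety sG"
    and "\<And>j. j \<in> unfrozen s - K \<Longrightarrow> w' base_vtx j = w v0 j"
  shows "reduction_map s v0 K w = w'"
  using reduction_map[OF assms(1)] assms(2,3)
  by (intro red.trop_variety_eqI[OF _ _ red.base_vtx_verts]) (auto simp: unfrozen_sG)

context
  fixes p :: "'i move list"
  assumes p: "set p \<subseteq> moves_in s K"
begin

lemma epaths: "epath s (v0, p)" "epath sG (reduced_path p)"
  using p v0 moves_in_moves moves_in_moves_sG red.base_vtx_verts
  by (auto simp: epath_def reduced_path_def)

text \<open>At \<open>base_vtx\<close> both sides have the retained coordinates of \<open>w\<close>
  at the end of the path.\<close>

lemma reduction_map_trop_act: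
  assumes w: "w \<in> trop_variety s"
  shows "reduction_map s v0 K (trop_act s (v0, p) w)
    = trop_act sG (reduced_path p) (reduction_map s v0 K w)"
proof (rule reduction_map_eqI)
  note r = reduction_map[OF w]
  show "trop_act s (v0, p) w \<in> trop_variety s"
    "trop_act sG (reduced_path p) (reduction_map s v0 K w) \<in> trop_variety sG"
    using trop_act(1)[OF epaths(1) w] red.trop_act(1)[OF epaths(2) r(1)] by auto
  fix j assume j: "j \<in> unfrozen s - K"
  have "trop_act sG (reduced_path p) (reduction_map s v0 K w) base_vtx j
    = reduction_map s v0 K w (target (reduced_path p)) j"
    using red.trop_act(2)[OF epaths(2) r(1)] by (simp add: reduced_path_def)
  also have "\<dots> = w (target (v0, p)) j"
    using corr_foldl_trop[OF corr_base p w r(1)] r(2) j by (simp add: target_def reduced_path_def)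
  also have "\<dots> = trop_act s (v0, p) w v0 j"
    using trop_act(2)[OF epaths(1) w] by simp
  finally show "trop_act sG (reduced_path p) (reduction_map s v0 K w) base_vtx j
    = trop_act s (v0, p) w v0 j" .
qed

lemma reduction_map_funpow:
  assumes "w \<in> trop_variety s"
  shows "reduction_map s v0 K ((trop_act s (v0, p) ^^ n) w)
    = (trop_act sG (reduced_path p) ^^ n) (reduction_map s v0 K w)"
  using trop_act_funpow[OF epaths(1) assms]
  by (induction n) (simp_all add: reduction_map_trop_act)

lemma sign_of_path_funpow:
  assumes "w \<in> trop_variety s"
  shows "sign_of_path (v0, p) ((trop_act s (v0, p) ^^ n) w)
    = sign_of_path (reduced_path p) ((trop_act sG (reduced_path p) ^^ n) (reduction_map s v0 K w))"
  unfolding sign_of_path_def reduced_path_def fst_conv snd_conv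
    reduction_map_funpow[OF assms, unfolded reduced_path_def, symmetric]
  using reduction_map[OF trop_act_funpow[OF epaths(1) assms]]
  by (intro signs_along_eq corr_base p trop_act_funpow[OF epaths(1) assms]) auto

text \<open>An equality of predicates, so that the choice in \<open>stable_sign\<close> gives the
  same tuple on both sides even where it is not unique.\<close>

lemma is_stable_sign_iff:
  assumes \<Omega>: "\<Omega> \<subseteq> trop_variety sG"
    and \<Omega>': "\<Omega>' = {w \<in> trop_variety s. reduction_map s v0 K w \<in> \<Omega> - {trop_zero}}"
  shows "is_stable_sign s (v0, p) \<Omega>' = is_stable_sign sG (reduced_path p) \<Omega>"
proof
  fix \<epsilon>
  \<comment> \<open>Zero reduces to zero, so it is not in \<open>\<Omega>'\<close> and removing it
    changes nothing.\<close>
  have "reduction_map s v0 K trop_zero = trop_zero"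
    by (rule reduction_map_eqI)
      (auto simp: trop_zero_variety red.trop_zero_variety, simp add: trop_zero_def)
  then have \<Omega>'_minus: "\<Omega>' - {trop_zero} = \<Omega>'" by (auto simp: \<Omega>')
  \<comment> \<open>The preimage has coordinate 0 at each label in \<open>K\<close>, where
    \<open>w'\<close> vanishes by convention.\<close>
  have onto: "\<exists>w\<in>\<Omega>'. reduction_map s v0 K w = w'" if "w' \<in> \<Omega> - {trop_zero}" for w'
  proof -
    obtain w where "w \<in> trop_variety s" "\<forall>j\<in>unfrozen s. w v0 j = w' base_vtx j"
      using trop_variety_ex[OF v0] by blast
    then show ?thesis
      using reduction_map_eqI[of w w'] that \<Omega> by (auto simp: \<Omega>')
  qed
  have "(\<forall>w\<in>\<Omega>'. \<exists>n0. \<forall>n\<ge>n0. sign_of_path (v0, p) ((trop_act s (v0, p) ^^ n) w) = \<epsilon>) \<longleftrightarrow>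
    (\<forall>w'\<in>\<Omega> - {trop_zero}. \<exists>n0. \<forall>n\<ge>n0.
      sign_of_path (reduced_path p) ((trop_act sG (reduced_path p) ^^ n) w') = \<epsilon>)"
    (is "?l \<longleftrightarrow> ?r")
  proof
    assume ?l
    show ?r
    proof
      fix w' assume "w' \<in> \<Omega> - {trop_zero}"
      then obtain w where w: "w \<in> \<Omega>'" "reduction_map s v0 K w = w'" using onto by blast
      then have "w \<in> trop_variety s" by (simp add: \<Omega>')
      moreover have "\<exists>n0. \<forall>n\<ge>n0. sign_of_path (v0, p) ((trop_act s (v0, p) ^^ n) w) = \<epsilon>"
        using \<open>?l\<close> w(1) by blast
      ultimately show "\<exists>n0. \<forall>n\<ge>n0.
        sign_of_path (reduced_path p) ((trop_act sG (reduced_path p) ^^ n) w') = \<epsilon>"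
        unfolding w(2)[symmetric] by (simp only: sign_of_path_funpow)
    qed
  next
    assume ?r
    then show ?l by (simp add: \<Omega>' sign_of_path_funpow)
  qed
  then show "is_stable_sign s (v0, p) \<Omega>' \<epsilon> = is_stable_sign sG (reduced_path p) \<Omega> \<epsilon>"
    unfolding is_stable_sign_def \<Omega>'_minus by (simp add: hor_length_def reduced_path_def)
qed

text \<open>Checks the hypotheses of \<open>spectral_radius_block_triangular\<close> for one common
  tuple of signs.\<close>

lemma spectral_radius_eq:
  assumes \<epsilon>: "set \<epsilon> \<subseteq> {1, -1}" "length \<epsilon> = length (filter (\<lambda>a. \<exists>k. a = Hor k) p)"
    and ne: "unfrozen s - K \<noteq> {}"
    and L: "L = (\<lambda>i c. complex_of_real (presentation s v0 p \<epsilon> (\<lambda>j. if j = c then 1 else 0) i))"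
    and L': "L' = (\<lambda>i c. complex_of_real
      (presentation sG base_vtx p \<epsilon> (\<lambda>j. if j = c then 1 else 0) i))"
  shows "spectral_radius (index_mat (unfrozen s) L) = spectral_radius (index_mat (unfrozen s - K) L')"
proof -
  let ?J = "unfrozen s - K"
  let ?P = "presentation s v0 p \<epsilon>"
  have fin: "finite ?J" using finite_unfrozen by simp
  have stJ: "\<forall>a\<in>set p. stabilizes ?J a" using p moves_in_stabilizes(1) by blast
  have UJ: "unfrozen s - ?J = K" using K by blast
  have "L i c = L' i c" if "i \<in> ?J" for i c
    unfolding L L' using presentation_eq[OF corr_base p _ that] by metis
  then have "index_mat ?J L = index_mat ?J L'"
    by (intro index_mat_cong fin) auto
  moreover have "spectral_radius (index_mat (unfrozen s) L) = spectral_radius (index_mat ?J L)"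
  proof -
    obtain \<pi> where \<pi>: "\<pi> permutes K"
      "\<And>x i. \<forall>j\<in>?J. x j = 0 \<Longrightarrow> i \<in> K \<Longrightarrow> ?P x i = x (\<pi> i)"
      using presentation_off_block[of p ?J K s v0 \<epsilon>] moves_in_stabilizes p by blast
    show ?thesis
    proof (rule spectral_radius_block_triangular[OF finite_unfrozen _ ne, of L \<pi>])
      show "?J \<subseteq> unfrozen s" by blast
      show "\<pi> permutes (unfrozen s - ?J)" using \<pi>(1) UJ by simp
      show "L i c = (if c = \<pi> i then 1 else 0)"
        if "i \<in> unfrozen s - ?J" "c \<in> unfrozen s - ?J" for i c
      proof -
        have "?P (\<lambda>j. if j = c then 1 else 0) i = (if \<pi> i = c then 1 else 0)"
          using that unfolding UJ by (intro \<pi>(2)) auto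
        then show ?thesis by (simp add: L)
      qed
      \<comment> \<open>Outside \<open>K\<close> the unit vector at \<open>c\<close> agrees with the
        zero vector, which a linear map sends to zero.\<close>
      show "L i c = 0" if "i \<in> ?J" "c \<in> unfrozen s - ?J" for i c
      proof -
        have "?P (\<lambda>j. if j = c then 1 else 0) i = presentation sG base_vtx p \<epsilon> (\<lambda>_. 0) i"
          using that by (intro presentation_eq[OF corr_base p]) auto
        also have "\<dots> = 0"
          using red.finite_unfrozen stJ that presentation_linear[of ?J p i sG base_vtx \<epsilon> "\<lambda>_. 0"]
          by (simp add: unfrozen_sG)
        finally show ?thesis by (simp add: L)
      qed
      show "1 \<le> spectral_radius (index_mat ?J L)"
      proof (rule spectral_radius_integer_mat_ge_1[OF fin ne])
        show "L i j \<in> \<int>" for i j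
          using presentation_Ints[OF \<epsilon>, of "\<lambda>l. if l = j then 1 else 0" s v0 i]
          by (auto simp: L elim!: Ints_cases)
      next
        fix x i assume x: "\<forall>i\<in>?J. (\<Sum>c\<in>?J. L i c * x c) = 0" and i: "i \<in> ?J"
        \<comment> \<open>Injectivity is known for real vectors, so the real and imaginary parts of
          \<open>x\<close> are treated separately.\<close>
        have "?P (\<lambda>c. Re (x c)) j = 0" "?P (\<lambda>c. Im (x c)) j = 0" if j: "j \<in> ?J" for j
        proof -
          have "(\<Sum>c\<in>?J. L j c * x c) = 0" using x j by blast
          from arg_cong[OF this, of Re] arg_cong[OF this, of Im]
          show "?P (\<lambda>c. Re (x c)) j = 0" "?P (\<lambda>c. Im (x c)) j = 0"
            unfolding presentation_linear[OF fin stJ j, of s v0 \<epsilon> "\<lambda>c. Re (x c)"]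
              presentation_linear[OF fin stJ j, of s v0 \<epsilon> "\<lambda>c. Im (x c)"]
            by (simp_all add: L Re_sum Im_sum)
        qed
        then have "Re (x i) = 0" "Im (x i) = 0"
          using presentation_eq_0D[OF stJ _ i, of s v0 \<epsilon>] by blast+
        then show "x i = 0" by (simp add: complex_eq_iff)
      qed
    qed
  qed
  ultimately show ?thesis by simp
qed

end

end

section \<open>Sign stability and spectral radii under reduction\<close>

theorem theorem1p6:
  fixes s sG :: "'i::linorder seed_data"
    and r v0 :: "'i vtx"
    and S :: "'i ratfun set"
    and K :: "'i set"
    and p :: "'i move list"
    and \<Omega> \<Omega>' :: "'i trop_point set"
  assumes "seed_pattern s"
    and "r \<in> verts s" and "S \<in> FZ_complex s r"
    and "v0 \<in> verts s" and "cluster s r v0 \<in> star_clusters s r S"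
    and "K = simplex_labels s r S v0"
    and "sG = reduced_pattern s v0 K"
    and "path_in s v0 K (v0, p)" and "loop_path s (v0, p)"
    and "mutation_loop s (v0, p) \<in> reduced_loops s v0 K"
    and "\<Omega> \<subseteq> trop_variety sG" and "scaling_invariant \<Omega>"
    and "\<Omega>' = {w \<in> trop_variety s. reduction_map s v0 K w \<in> \<Omega> - {trop_zero}}"
  shows "(sign_stable sG (reduced_path p) \<Omega> \<longleftrightarrow> sign_stable s (v0, p) \<Omega>') \<and>
    (sign_stable s (v0, p) \<Omega>' \<and> unfrozen sG \<noteq> {} \<longrightarrow>
       spectral_radius (presentation_matrix s (v0, p) \<Omega>') =
       spectral_radius (presentation_matrix sG (reduced_path p) \<Omega>))"
proof -
  interpret reduction s v0 K sG
    using assms(1,4,6,7) by unfold_locales (auto simp: simplex_labels_def)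
  have p: "set p \<subseteq> moves_in s K" using assms(8) by (simp add: path_in_def)
  have stable: "is_stable_sign s (v0, p) \<Omega>' = is_stable_sign sG (reduced_path p) \<Omega>"
    by (rule is_stable_sign_iff[OF p assms(11,13)])
  let ?\<epsilon> = "stable_sign s (v0, p) \<Omega>'"
  have "spectral_radius (presentation_matrix s (v0, p) \<Omega>') =
      spectral_radius (presentation_matrix sG (reduced_path p) \<Omega>)"
    if "sign_stable s (v0, p) \<Omega>'" "unfrozen sG \<noteq> {}"
  proof -
    have "is_stable_sign s (v0, p) \<Omega>' ?\<epsilon>"
      using that(1) unfolding sign_stable_def stable_sign_def by (rule someI_ex)
    then have \<epsilon>: "set ?\<epsilon> \<subseteq> {1, -1}" "length ?\<epsilon> = length (filter (\<lambda>a. \<exists>k. a = Hor k) p)"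
      unfolding is_stable_sign_def hor_length_def by simp_all
    \<comment> \<open>The choice operator is applied to the same predicate on both sides.\<close>
    have "stable_sign sG (reduced_path p) \<Omega> = ?\<epsilon>"
      by (simp add: stable_sign_def stable)
    then show ?thesis
      using spectral_radius_eq[OF p \<epsilon> _ refl refl] that(2)
      unfolding presentation_matrix_def Let_def index_mat_def unfrozen_sG
      by (simp add: reduced_path_def)
  qed
  then show ?thesis by (auto simp: sign_stable_def stable)
qed

end
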